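(* Let $d\ge 3$. For every state $\varrho\in\mathcal{E}^{\mathrm{a}}$, with correlation matrix $tV$, $V\in \mathrm{G}(d)$, one has $$D_1^M(\varrho)=|t|,\qquad -\frac{d}{2(d-1)}\le t\le\frac{d}{2(d+1)}.$$ Similarly, for every state $\varrho\in\mathcal{E}^{\mathrm{aa}}$, with correlation matrix $t\,V_1I_0V_2^{T}$, $V_1,V_2\in\mathrm{G}(d)$, one has $$D_1^M(\varrho)=\frac{2}{d}\,|t|,\qquad -\frac{d}{2(d^{2}-1)}\le t\le\frac{d}{2}.$$ (In each case the displayed interval is the range of values of $t$ for which the correlation matrix defines a state.)
   Context: Generators: $\lambda_{1},\dots,\lambda_{d^{2}-1}$ are the standard (generalized Gell-Mann) Hermitian generators of $\mathrm{su}(d)$: for $k=2,\dots,d$ and $1\le j<k$, $\lambda_{(k-1)^{2}+2(j-1)}=E_{jk}+E_{kj}$, $\lambda_{(k-1)^{2}+2(j-1)+1}=-i(E_{jk}-E_{kj})$, and $\lambda_{k^{2}-1}=\sqrt{\tfrac{2}{k(k-1)}}\,\mathrm{diag}(1,\dots,1,-(k-1),0,\dots,0)$ (with $k-1$ ones), where $E_{jk}$ are matrix units. They satisfy $\operatorname{tr}\lambda_j=0$, $\operatorname{tr}(\lambda_j\lambda_k)=2\delta_{jk}$. For $n\in\mathbb{R}^{d^{2}-1}$, $\langle n,\lambda\rangle=\sum_j n_j\lambda_j$; $\{e_j\}$ is the canonical basis of $\mathbb{R}^{d^{2}-1}$. Adjoint group: for $U\in\mathrm{SU}(d)$, $R(U)\in\mathrm{SO}(d^2-1)$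 is defined by $\langle R(U)m,\lambda\rangle=U\langle m,\lambda\rangle U^*$ for all $m\in\mathbb{R}^{d^2-1}$, and $\mathrm{G}(d)=\{R(U):U\in\mathrm{SU}(d)\}$. $I_0$ is the diagonal $(d^2-1)\times(d^2-1)$ matrix with $(I_0)_{kk}=\frac12\operatorname{tr}(\lambda_k^T\lambda_k)$; it represents transposition: $\langle I_0 a,\lambda\rangle=\langle a,\lambda\rangle^T$. States: a state of two qudits is a positive semidefinite operator of trace one on $\mathbb{C}^{d}\otimes\mathbb{C}^{d}$. A locally maximally mixed state with correlation matrix $\mathcal{K}\in M_{d^2-1}(\mathbb{R})$ is a state of the form $\varrho=\frac{1}{d^{2}}(\mathbb{1}_{d}\otimes\mathbb{1}_{d}+\sum_{j=1}^{d^2-1}\langle \mathcal{K}e_{j},\lambda\rangle\otimes\langle e_{j},\lambda\rangle)$. $\mathcal{E}^{\mathrm{a}}$ is the set of all such states with $\mathcal{K}=tV$, $t\in\mathbb{R}$, $V\in\mathrm{G}(d)$; $\mathcal{E}^{\mathrm{aa}}$ is the set of all such states with $\mathcal{K}=tV_1I_0V_2^T$, $t\in\mathbb{R}$, $V_1,V_2\in\mathrm{G}(d)$. Discord: a local projective measurement on the first subsystem is $\mathbb{P}_{\mathcal{A}}=\mathbb{P}\otimes\mathrm{id}$, $\mathbb{P}(A)=\sum_{k=1}^{d}P_kAP_k$, where $P_1,\dots,P_d$ are mutually orthogonal one-dimensional orthogonal projectors on $\mathbb{C}^d$ with $\sum_k P_k=\mathbb{1}_d$. With $\|A\|_1=\operatorname{tr}|A|$,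 $$D_1^M(\varrho)=\frac{d}{2(d-1)}\min_{\mathbb{P}_{\mathcal{A}}}\|\varrho-\mathbb{P}_{\mathcal{A}}(\varrho)\|_1,$$ the minimum being over all such measurements. *)

theory Defs
  imports
    "Jordan_Normal_Form.Schur_Decomposition"
    "Jordan_Normal_Form.DL_Rank"
    "HOL-Library.Discrete_Functions"
begin

definition matrix_sum :: "nat \<Rightarrow> nat \<Rightarrow> ('i \<Rightarrow> complex mat) \<Rightarrow> 'i set \<Rightarrow> complex mat" where
  "matrix_sum nr nc A I = mat nr nc (\<lambda>(i, j). \<Sum>k\<in>I. A k $$ (i, j))"

definition matrix_trace :: "complex mat \<Rightarrow> complex" where
  "matrix_trace A = (\<Sum>i<dim_row A. A $$ (i, i))"

text \<open>The standard basis of the tensor product of two coordinate spaces is ordered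
  lexicographically, so operators on it become Kronecker products.\<close>

definition kron :: "complex mat \<Rightarrow> complex mat \<Rightarrow> complex mat" where
  "kron A B = mat (dim_row A * dim_row B) (dim_col A * dim_col B)
     (\<lambda>(i, j). A $$ (i div dim_row B, j div dim_col B) * B $$ (i mod dim_row B, j mod dim_col B))"

definition psd :: "nat \<Rightarrow> complex mat \<Rightarrow> bool" where
  "psd n A \<longleftrightarrow> A \<in> carrier_mat n n \<and> mat_adjoint A = A \<and>
     (\<forall>v\<in>carrier_vec n. 0 \<le> Re ((A *\<^sub>v v) \<bullet>c v))"

definition is_state :: "nat \<Rightarrow> complex mat \<Rightarrow> bool" where
  "is_state n \<rho> \<longleftrightarrow> psd n \<rho> \<and> matrix_trace \<rho> = 1"

definition mat_abs :: "complex mat \<Rightarrow> complex mat" where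
  "mat_abs A = (THE B. psd (dim_col A) B \<and> B * B = mat_adjoint A * A)"

definition trace_norm :: "complex mat \<Rightarrow> real" where
  "trace_norm A = Re (matrix_trace (mat_abs A))"

text \<open>Labels of matrix units and of generators start from 1, whereas matrix entries are
  indexed from 0.\<close>

definition mat_unit :: "nat \<Rightarrow> nat \<Rightarrow> nat \<Rightarrow> complex mat" where
  "mat_unit d j k = mat d d (\<lambda>(a, b). if Suc a = j \<and> Suc b = k then 1 else 0)"

definition gell_mann_diag :: "nat \<Rightarrow> nat \<Rightarrow> complex mat" where
  "gell_mann_diag d k =
     complex_of_real (sqrt (2 / (real k * (real k - 1)))) \<cdot>\<^sub>m
       mat_diag d (\<lambda>a. if Suc a < k then 1 else if Suc a = k then - (of_nat k - 1) else 0)"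

text \<open>The generators with \<open>(k - 1)\<^sup>2 \<le> l < k\<^sup>2\<close> are those for which
  \<open>k\<close> is the last row with a nonzero entry, so \<open>k\<close> is recovered as \<open>floor_sqrt l + 1\<close>;
  lemmas \<open>gell_mann_sym\<close>, \<open>gell_mann_antisym\<close> and
  \<open>gell_mann_diagonal\<close> give the usual description.\<close>

definition gell_mann :: "nat \<Rightarrow> nat \<Rightarrow> complex mat" where
  "gell_mann d l =
     (let k = floor_sqrt l + 1; r = l - (k - 1)\<^sup>2; j = r div 2 + 1
      in if r = 2 * (k - 1) then gell_mann_diag d k
         else if even r then mat_unit d j k + mat_unit d k j
         else (- \<i>) \<cdot>\<^sub>m (mat_unit d j k - mat_unit d k j))"

lemma floor_sqrt_block:
  assumes "1 \<le> k" "r \<le> 2 * (k - 1)"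
  shows "floor_sqrt ((k - 1)\<^sup>2 + r) = k - 1"
proof (rule floor_sqrt_unique)
  show "(k - 1)\<^sup>2 \<le> (k - 1)\<^sup>2 + r" by simp
  show "(k - 1)\<^sup>2 + r < (Suc (k - 1))\<^sup>2"
    using assms(2) by (simp add: power2_eq_square)
qed

lemma gell_mann_sym:
  assumes "2 \<le> k" "k \<le> d" "1 \<le> j" "j < k"
  shows "gell_mann d ((k - 1)\<^sup>2 + 2 * (j - 1)) = mat_unit d j k + mat_unit d k j"
proof -
  have "floor_sqrt ((k - 1)\<^sup>2 + 2 * (j - 1)) = k - 1"
    by (rule floor_sqrt_block) (use assms in auto)
  then show ?thesis
    unfolding gell_mann_def Let_def using assms by auto
qed

lemma gell_mann_antisym:
  assumes "2 \<le> k" "k \<le> d" "1 \<le> j" "j < k"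
  shows "gell_mann d ((k - 1)\<^sup>2 + 2 * (j - 1) + 1) =
    (- \<i>) \<cdot>\<^sub>m (mat_unit d j k - mat_unit d k j)"
proof -
  have "floor_sqrt ((k - 1)\<^sup>2 + (2 * (j - 1) + 1)) = k - 1"
    by (rule floor_sqrt_block) (use assms in auto)
  moreover have "2 * (j - 1) + 1 \<noteq> 2 * (k - 1)" by presburger
  ultimately show ?thesis
    unfolding gell_mann_def Let_def using assms by (auto simp: add.assoc)
qed

lemma gell_mann_diagonal:
  assumes "2 \<le> k" "k \<le> d"
  shows "gell_mann d (k\<^sup>2 - 1) = gell_mann_diag d k"
proof -
  have eq: "k\<^sup>2 - 1 = (k - 1)\<^sup>2 + 2 * (k - 1)"
    using assms(1) by (cases k) (auto simp: power2_eq_square)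
  have "floor_sqrt ((k - 1)\<^sup>2 + 2 * (k - 1)) = k - 1"
    by (rule floor_sqrt_block) (use assms in auto)
  then show ?thesis
    unfolding eq gell_mann_def Let_def using assms by auto
qed

text \<open>The pairing \<open>\<langle>n, \<lambda>\<rangle>\<close> of a coefficient vector with the generators.\<close>

definition gm_comb :: "nat \<Rightarrow> real vec \<Rightarrow> complex mat" where
  "gm_comb d n =
     matrix_sum d d (\<lambda>j. complex_of_real (n $ (j - 1)) \<cdot>\<^sub>m gell_mann d j) {1..d\<^sup>2 - 1}"

definition special_unitary :: "nat \<Rightarrow> complex mat set" where
  "special_unitary d = {U \<in> carrier_mat d d. U * mat_adjoint U = 1\<^sub>m d \<and> det U = 1}"

text \<open>Orthogonality of \<open>R\<close> and \<open>det R = 1\<close> are consequences of this defining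
  relation, as is the uniqueness of \<open>R\<close> for given \<open>U\<close>.\<close>

definition adjoint_rep :: "nat \<Rightarrow> complex mat \<Rightarrow> real mat \<Rightarrow> bool" where
  "adjoint_rep d U R \<longleftrightarrow> R \<in> carrier_mat (d\<^sup>2 - 1) (d\<^sup>2 - 1) \<and>
     (\<forall>m\<in>carrier_vec (d\<^sup>2 - 1). gm_comb d (R *\<^sub>v m) = U * gm_comb d m * mat_adjoint U)"

definition adjoint_group :: "nat \<Rightarrow> real mat set" where
  "adjoint_group d = {R. \<exists>U\<in>special_unitary d. adjoint_rep d U R}"

definition I0 :: "nat \<Rightarrow> real mat" where
  "I0 d = mat_diag (d\<^sup>2 - 1)
     (\<lambda>k. Re (matrix_trace (transpose_mat (gell_mann d (Suc k)) * gell_mann d (Suc k))) / 2)"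

definition lmm_operator :: "nat \<Rightarrow> real mat \<Rightarrow> complex mat" where
  "lmm_operator d K = complex_of_real (1 / (real d)\<^sup>2) \<cdot>\<^sub>m
     (kron (1\<^sub>m d) (1\<^sub>m d) +
      matrix_sum (d * d) (d * d)
        (\<lambda>j. kron (gm_comb d (K *\<^sub>v unit_vec (d\<^sup>2 - 1) (j - 1)))
                  (gm_comb d (unit_vec (d\<^sup>2 - 1) (j - 1)))) {1..d\<^sup>2 - 1})"

definition states_a :: "nat \<Rightarrow> complex mat set" where
  "states_a d = {\<rho>. is_state (d * d) \<rho> \<and>
     (\<exists>t. \<exists>V\<in>adjoint_group d. \<rho> = lmm_operator d (t \<cdot>\<^sub>m V))}"

definition states_aa :: "nat \<Rightarrow> complex mat set" where
  "states_aa d = {\<rho>. is_state (d * d) \<rho> \<and>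
     (\<exists>t. \<exists>V\<^sub>1\<in>adjoint_group d. \<exists>V\<^sub>2\<in>adjoint_group d.
        \<rho> = lmm_operator d (t \<cdot>\<^sub>m (V\<^sub>1 * I0 d * transpose_mat V\<^sub>2)))}"

definition projective_measurement :: "nat \<Rightarrow> (nat \<Rightarrow> complex mat) \<Rightarrow> bool" where
  "projective_measurement d P \<longleftrightarrow>
     (\<forall>k<d. P k \<in> carrier_mat d d \<and> mat_adjoint (P k) = P k \<and> P k * P k = P k \<and>
            vec_space.rank d (P k) = 1) \<and>
     (\<forall>j<d. \<forall>k<d. j \<noteq> k \<longrightarrow> P j * P k = 0\<^sub>m d d) \<and>
     matrix_sum d d P {..<d} = 1\<^sub>m d"

definition measure_map :: "nat \<Rightarrow> (nat \<Rightarrow> complex mat) \<Rightarrow> complex mat \<Rightarrow> complex mat" where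
  "measure_map d P A = matrix_sum d d (\<lambda>k. P k * A * P k) {..<d}"

text \<open>The extension of \<open>measure_map d P\<close> by the identity on the second factor; it is
  linear and acts on product operators as stated in \<open>local_measure_map_kron\<close> below.\<close>

definition local_measure_map :: "nat \<Rightarrow> (nat \<Rightarrow> complex mat) \<Rightarrow> complex mat \<Rightarrow> complex mat" where
  "local_measure_map d P X =
     matrix_sum (d * d) (d * d) (\<lambda>k. kron (P k) (1\<^sub>m d) * X * kron (P k) (1\<^sub>m d)) {..<d}"

lemma sum_div_mod:
  fixes f :: "nat \<Rightarrow> nat \<Rightarrow> 'a::comm_monoid_add"
  assumes "0 < m"
  shows "(\<Sum>l<n * m. f (l div m) (l mod m)) = (\<Sum>a<n. \<Sum>b<m. f a b)"
proof -
  have "(\<Sum>l<n * m. f (l div m) (l mod m)) =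
      (\<Sum>a<n. \<Sum>l\<in>{a * m..<a * m + m}. f (l div m) (l mod m))"
    by (rule sum.nat_group[symmetric])
  also have "\<dots> = (\<Sum>a<n. \<Sum>b<m. f a b)"
  proof (rule sum.cong[OF refl])
    fix a
    have "(\<Sum>l\<in>{a * m..<a * m + m}. f (l div m) (l mod m)) =
        (\<Sum>b\<in>{0..<m}. f ((b + a * m) div m) ((b + a * m) mod m))"
      using sum.shift_bounds_nat_ivl[of "\<lambda>l. f (l div m) (l mod m)" 0 "a * m" m]
      by (simp add: add.commute)
    also have "\<dots> = (\<Sum>b<m. f a b)"
      by (rule sum.cong) (use assms in auto)
    finally show "(\<Sum>l\<in>{a * m..<a * m + m}. f (l div m) (l mod m)) = (\<Sum>b<m. f a b)" .
  qed
  finally show ?thesis .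
qed

lemma dim_kron [simp]:
  "dim_row (kron A B) = dim_row A * dim_row B" "dim_col (kron A B) = dim_col A * dim_col B"
  by (simp_all add: kron_def)

lemma kron_carrier [simp]:
  "A \<in> carrier_mat a b \<Longrightarrow> B \<in> carrier_mat c e \<Longrightarrow> kron A B \<in> carrier_mat (a * c) (b * e)"
  by (auto simp: kron_def)

lemma kron_mult:
  assumes A: "A \<in> carrier_mat d d" and B: "B \<in> carrier_mat d d"
    and C: "C \<in> carrier_mat d d" and D: "D \<in> carrier_mat d d"
  shows "kron A B * kron C D = kron (A * C) (B * D)"
proof (rule eq_matI)
  fix i j
  assume "i < dim_row (kron (A * C) (B * D))" "j < dim_col (kron (A * C) (B * D))"
  then have ij: "i < d * d" "j < d * d" using assms by auto
  then have d: "0 < d" by (cases d) auto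
  have lt: "i div d < d" "j div d < d" "i mod d < d" "j mod d < d"
    using ij d by (auto simp: less_mult_imp_div_less)
  have "(kron A B * kron C D) $$ (i, j) =
      (\<Sum>l<d * d. (A $$ (i div d, l div d) * C $$ (l div d, j div d)) *
                  (B $$ (i mod d, l mod d) * D $$ (l mod d, j mod d)))"
    using ij assms by (auto simp: scalar_prod_def kron_def atLeast0LessThan intro!: sum.cong)
  also have "\<dots> = (\<Sum>a<d. \<Sum>b<d. (A $$ (i div d, a) * C $$ (a, j div d)) *
                  (B $$ (i mod d, b) * D $$ (b, j mod d)))"
    by (rule sum_div_mod[OF d])
  also have "\<dots> = (\<Sum>a<d. A $$ (i div d, a) * C $$ (a, j div d)) *
      (\<Sum>b<d. B $$ (i mod d, b) * D $$ (b, j mod d))"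
    by (simp add: sum_product)
  also have "\<dots> = kron (A * C) (B * D) $$ (i, j)"
    using ij lt assms by (auto simp: scalar_prod_def kron_def atLeast0LessThan)
  finally show "(kron A B * kron C D) $$ (i, j) = kron (A * C) (B * D) $$ (i, j)" .
qed (use assms in auto)

lemma local_measure_map_kron:
  assumes A: "A \<in> carrier_mat d d" and B: "B \<in> carrier_mat d d"
    and P: "\<And>k. k < d \<Longrightarrow> P k \<in> carrier_mat d d"
  shows "local_measure_map d P (kron A B) = kron (measure_map d P A) B"
proof (rule eq_matI)
  show "dim_row (local_measure_map d P (kron A B)) = dim_row (kron (measure_map d P A) B)"
    "dim_col (local_measure_map d P (kron A B)) = dim_col (kron (measure_map d P A) B)"
    using B by (auto simp: local_measure_map_def measure_map_def matrix_sum_def)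
  fix i j
  assume "i < dim_row (kron (measure_map d P A) B)" "j < dim_col (kron (measure_map d P A) B)"
  then have ij: "i < d * d" "j < d * d"
    using B by (auto simp: measure_map_def matrix_sum_def)
  then have d: "0 < d" by (cases d) auto
  have lt: "i div d < d" "j div d < d"
    using ij by (auto simp: less_mult_imp_div_less)
  have *: "kron (P k) (1\<^sub>m d) * kron A B * kron (P k) (1\<^sub>m d) = kron (P k * A * P k) B"
    if "k < d" for k
    using A B P[OF that] by (simp add: kron_mult[where d = d])
  have "local_measure_map d P (kron A B) $$ (i, j) = (\<Sum>k<d. kron (P k * A * P k) B $$ (i, j))"
    using ij by (auto simp: local_measure_map_def matrix_sum_def * intro!: sum.cong simp del: index_mult_mat)
  also have "\<dots> = (\<Sum>k<d. (P k * A * P k) $$ (i div d, j div d) * B $$ (i mod d, j mod d))"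
    using ij A B P[THEN carrier_matD(1)] P[THEN carrier_matD(2)]
    by (intro sum.cong) (auto simp: kron_def simp del: index_mult_mat(1))
  also have "\<dots> = kron (measure_map d P A) B $$ (i, j)"
    using ij lt A B
    by (simp del: index_mult_mat(1) add: kron_def measure_map_def matrix_sum_def sum_distrib_right)
  finally show "local_measure_map d P (kron A B) $$ (i, j) = kron (measure_map d P A) B $$ (i, j)" .
qed

text \<open>The minimum is the least element of the (infinite) set of values, not merely its infimum.\<close>

definition discord :: "nat \<Rightarrow> complex mat \<Rightarrow> real" where
  "discord d \<rho> = real d / (2 * (real d - 1)) *
     (LEAST x. \<exists>P. projective_measurement d P \<and> x = trace_norm (\<rho> - local_measure_map d P \<rho>))"

end

theory Submission
  imports Defs
begin

text \<open>Completeness of the generators, \<open>\<Sum> \<lambda>\<^sub>l \<otimes> \<lambda>\<^sub>l = 2 (F - 1/d)\<close> with \<open>F\<close> the flip, shows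
  that \<open>\<rho> = ((1 - 2t/d) 1 + 2t X) / d\<^sup>2\<close>, where \<open>X\<close> is \<open>F\<close> conjugated by \<open>U \<otimes> 1\<close> in the first
  family and \<open>d\<close> times the projection onto a maximally entangled vector (a conjugate of the
  partial transpose of \<open>F\<close>) in the second. So \<open>X\<close> has exactly the eigenvalues \<open>1, -1\<close>,
  respectively \<open>d, 0\<close>, which gives the range of \<open>t\<close>.

  For the projectors \<open>Q\<^sub>k = P\<^sub>k \<otimes> 1\<close> and \<open>Y = \<Sum> Q\<^sub>k X Q\<^sub>k\<close> the absolute value of \<open>X - Y\<close>
  is explicit. In the first family \<open>Y = X R\<close> with a projection \<open>R\<close> of rank \<open>d\<close>, so
  \<open>\<bar>X - Y\<bar> = 1 - R\<close> has trace \<open>d\<^sup>2 - d\<close>. In the second \<open>Y\<close> is a projection of rank \<open>d\<close> with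
  \<open>X Y = Y X = X\<close>, so \<open>\<bar>X - Y\<bar> = Y + (d - 2)/d X\<close> has trace \<open>2 (d - 1)\<close>. The trace norm does
  not depend on the measurement, so there is nothing to minimise.\<close>

section \<open>Adjoints and positive semidefinite matrices\<close>

text \<open>\<open>mat_abs\<close> is a definite description, so an absolute value is available only
  once a positive square root has been exhibited and is known to be unique; this is why uniqueness
  of positive roots comes before any state. No diagonalisation is used: all spectral information is
  read off from polynomial relations (\<open>X * X = 1\<close>, or \<open>X * X = d X\<close>), from
  the trace of \<open>X\<close>, and from the relations between \<open>X\<close> and the
  \<open>Q k\<close>. The traces cannot depend on the measurement, because the \<open>P k\<close>
  enter only as mutually orthogonal projections of trace one that add up to the identity; trace one
  is drawn from rank one. The identity part of a state is left unchanged by every measurement, so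
  the disturbance is \<open>2 t / d^2\<close> times \<open>X - Y\<close>. With the normalising
  factor this gives \<open>d / (2 (d - 1)) * 2 |t| / d^2 * d (d - 1) = |t|\<close> in the first
  family; in the second the last factor is \<open>2 (d - 1)\<close> and the result is
  \<open>2 |t| / d\<close>.\<close>

lemma mat_adjoint_dim [simp]:
  "dim_row (mat_adjoint A) = dim_col A" "dim_col (mat_adjoint A) = dim_row A"
  by (simp_all add: mat_adjoint_def)

lemma mat_adjoint_carrier [simp]:
  "A \<in> carrier_mat m n \<Longrightarrow> mat_adjoint A \<in> carrier_mat n m"
  by (intro carrier_matI) auto

lemma mat_adjoint_index [simp]:
  assumes "i < dim_col A" "j < dim_row A"
  shows "mat_adjoint A $$ (i, j) = conjugate (A $$ (j, i))"
  using assms by (simp add: mat_adjoint_def mat_of_rows_index)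

lemma mat_adjoint_adjoint [simp]: "mat_adjoint (mat_adjoint A) = A"
  by (rule eq_matI) auto

lemma mat_adjoint_mult:
  fixes A B :: "'a::conjugatable_field mat"
  assumes "A \<in> carrier_mat m n" "B \<in> carrier_mat n l"
  shows "mat_adjoint (A * B) = mat_adjoint B * mat_adjoint A"
  by (rule eq_matI) (use assms in \<open>auto simp: scalar_prod_def sum_conjugate conjugate_dist_mul mult.commute\<close>)

lemma mat_adjoint_add:
  fixes A B :: "'a::conjugatable_field mat"
  assumes "A \<in> carrier_mat m n" "B \<in> carrier_mat m n"
  shows "mat_adjoint (A + B) = mat_adjoint A + mat_adjoint B"
  by (rule eq_matI) (use assms in \<open>auto simp: conjugate_dist_add\<close>)

lemma mat_adjoint_minus:
  fixes A B :: "complex mat"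
  assumes "A \<in> carrier_mat m n" "B \<in> carrier_mat m n"
  shows "mat_adjoint (A - B) = mat_adjoint A - mat_adjoint B"
  by (rule eq_matI) (use assms in auto)

lemma mat_adjoint_smult:
  fixes A :: "'a::conjugatable_field mat"
  shows "mat_adjoint (c \<cdot>\<^sub>m A) = conjugate c \<cdot>\<^sub>m mat_adjoint A"
  by (rule eq_matI) (auto simp: conjugate_dist_mul)

lemma mat_adjoint_one [simp]: "mat_adjoint (1\<^sub>m n :: complex mat) = 1\<^sub>m n"
  by (rule eq_matI) auto

lemma cscalar_prod_adjoint:
  fixes A :: "complex mat"
  assumes "A \<in> carrier_mat m n" "v \<in> carrier_vec n" "w \<in> carrier_vec m"
  shows "(A *\<^sub>v v) \<bullet>c w = v \<bullet>c (mat_adjoint A *\<^sub>v w)"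
proof -
  have "(A *\<^sub>v v) \<bullet>c w = (\<Sum>i<m. \<Sum>j<n. A $$ (i, j) * v $ j * cnj (w $ i))"
    using assms by (simp add: scalar_prod_def atLeast0LessThan sum_distrib_right)
  also have "\<dots> = (\<Sum>j<n. \<Sum>i<m. A $$ (i, j) * v $ j * cnj (w $ i))"
    by (rule sum.swap)
  also have "\<dots> = v \<bullet>c (mat_adjoint A *\<^sub>v w)"
    using assms by (simp add: scalar_prod_def atLeast0LessThan sum_distrib_left mult_ac)
  finally show ?thesis .
qed

lemma mult_mat_unit_vec:
  fixes A :: "'a::semiring_1 mat"
  assumes "A \<in> carrier_mat m n" "i < n"
  shows "A *\<^sub>v unit_vec n i = col A i"
  using assms by (intro eq_vecI) auto

lemma smult_mat_mult_vec:
  fixes A :: "'a::comm_ring_1 mat"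
  assumes "A \<in> carrier_mat m n" "v \<in> carrier_vec n"
  shows "(c \<cdot>\<^sub>m A) *\<^sub>v v = c \<cdot>\<^sub>v (A *\<^sub>v v)"
  using assms by (intro eq_vecI) (auto simp: row_smult)

lemma smult_smult_mat:
  fixes A :: "'a::semigroup_mult mat"
  shows "a \<cdot>\<^sub>m (b \<cdot>\<^sub>m A) = (a * b) \<cdot>\<^sub>m A"
  by (rule eq_matI) (auto simp: mult.assoc)

lemma cscalar_prod_self:
  fixes v :: "complex vec"
  shows "v \<bullet>c v = of_real (\<Sum>i<dim_vec v. (cmod (v $ i))\<^sup>2)"
  by (simp add: scalar_prod_def atLeast0LessThan complex_norm_square del: of_real_power)

lemma psdI_gram:
  assumes "A \<in> carrier_mat m n"
  shows "psd n (mat_adjoint A * A)"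
  unfolding psd_def
proof (intro conjI ballI)
  show "mat_adjoint A * A \<in> carrier_mat n n" using assms by auto
  show "mat_adjoint (mat_adjoint A * A) = mat_adjoint A * A"
    using assms by (simp add: mat_adjoint_mult[of _ n m _ n])
  fix v :: "complex vec" assume v: "v \<in> carrier_vec n"
  have "(mat_adjoint A * A *\<^sub>v v) \<bullet>c v = (A *\<^sub>v v) \<bullet>c (A *\<^sub>v v)"
    using cscalar_prod_adjoint[of "mat_adjoint A" n m "A *\<^sub>v v" v] assms v
    by (simp add: assoc_mult_mat_vec[of _ n m])
  then show "0 \<le> Re ((mat_adjoint A * A *\<^sub>v v) \<bullet>c v)"
    by (simp add: cscalar_prod_self sum_nonneg)
qed

lemma psd_add:
  assumes "psd n A" "psd n B"
  shows "psd n (A + B)"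
  using assms unfolding psd_def
  by (auto simp: mat_adjoint_add[of _ n n] add_mult_distrib_mat_vec[of _ n n] add_scalar_prod_distrib[of _ n])

lemma psd_smult:
  assumes "psd n A" "0 \<le> c"
  shows "psd n (complex_of_real c \<cdot>\<^sub>m A)"
proof -
  have A: "A \<in> carrier_mat n n" using assms by (auto simp: psd_def)
  have "(complex_of_real c \<cdot>\<^sub>m A *\<^sub>v v) \<bullet>c v = complex_of_real c * ((A *\<^sub>v v) \<bullet>c v)"
    if "v \<in> carrier_vec n" for v
    using that A by (simp add: smult_mat_mult_vec[of _ n n] smult_scalar_prod_distrib[of _ n])
  then show ?thesis
    using assms by (auto simp: psd_def mat_adjoint_smult)
qed

text \<open>Here \<open>A\<close> is \<open>1/c\<close> times its own Gram matrix. The factor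
  \<open>c\<close> lets one criterion serve projections (\<open>c = 1\<close>), the unnormalised
  entangled projection (\<open>c = d\<close>) and shifted operators such as
  \<open>X - p\<close>.\<close>

lemma psd_hermitian_square:
  assumes "A \<in> carrier_mat n n" "mat_adjoint A = A" "A * A = complex_of_real c \<cdot>\<^sub>m A" "0 < c"
  shows "psd n A"
proof -
  have "A = complex_of_real (1 / c) \<cdot>\<^sub>m (mat_adjoint A * A)"
    using assms by (auto intro!: eq_matI simp del: index_mult_mat)
  then show ?thesis
    using psd_smult[OF psdI_gram[OF assms(1)], of "1/c"] assms(4) by simp
qed

text \<open>If the form of \<open>A\<close> vanishes at \<open>v\<close>, then nonnegativity at \<open>v - s A v\<close>
  for all small \<open>s > 0\<close> gives \<open>A v = 0\<close>.\<close>

lemma psd_form_zero: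
  assumes "psd n A" and v: "v \<in> carrier_vec n" and z: "Re ((A *\<^sub>v v) \<bullet>c v) = 0"
  shows "A *\<^sub>v v = 0\<^sub>v n"
proof (rule ccontr)
  assume ne: "A *\<^sub>v v \<noteq> 0\<^sub>v n"
  have A: "A \<in> carrier_mat n n" and h: "mat_adjoint A = A"
    and pos: "\<And>v. v \<in> carrier_vec n \<Longrightarrow> 0 \<le> Re ((A *\<^sub>v v) \<bullet>c v)"
    using assms by (auto simp: psd_def)
  define w where "w = A *\<^sub>v v"
  have w: "w \<in> carrier_vec n" using A v by (simp add: w_def)
  define q where "q = Re (w \<bullet>c w)"
  define r where "r = Re ((A *\<^sub>v w) \<bullet>c w)"
  have "q \<ge> 0" by (simp add: q_def cscalar_prod_self sum_nonneg)
  moreover have "q \<noteq> 0"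
  proof
    assume "q = 0"
    then have "w \<bullet>c w = 0" by (simp add: q_def cscalar_prod_self)
    then show False using ne w by (simp add: w_def)
  qed
  ultimately have q: "q > 0" by simp
  have r: "r \<ge> 0" using pos[OF w] by (simp add: r_def)
  have ineq: "2 * s * q \<le> s\<^sup>2 * r" for s :: real
  proof -
    define x where "x = v - complex_of_real s \<cdot>\<^sub>v w"
    have x: "x \<in> carrier_vec n" using v w by (simp add: x_def)
    have Ax: "A *\<^sub>v x = w - complex_of_real s \<cdot>\<^sub>v (A *\<^sub>v w)"
      using A v w by (simp add: x_def mult_minus_distrib_mat_vec mult_mat_vec w_def)
    have c1: "(A *\<^sub>v w) \<bullet>c v = w \<bullet>c w"
      using cscalar_prod_adjoint[OF A w v] by (simp add: h w_def)
    have cx: "conjugate x = conjugate v - complex_of_real s \<cdot>\<^sub>v conjugate w"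
      using v w by (auto simp: x_def)
    have "(A *\<^sub>v x) \<bullet>c x = w \<bullet>c v - complex_of_real s * (w \<bullet>c w)
        - complex_of_real s * ((A *\<^sub>v w) \<bullet>c v - complex_of_real s * ((A *\<^sub>v w) \<bullet>c w))"
      unfolding Ax cx using A v w
      by (simp add: minus_scalar_prod_distrib[of _ n] scalar_prod_minus_distrib[of _ n]
          algebra_simps)
    from arg_cong[OF this, of Re] have "Re ((A *\<^sub>v x) \<bullet>c x) = - 2 * s * q + s\<^sup>2 * r"
      using z by (simp add: c1 q_def r_def w_def[symmetric] power2_eq_square algebra_simps)
    then show ?thesis using pos[OF x] by simp
  qed
  \<comment> \<open>Any small \<open>s > 0\<close> violates \<open>ineq\<close>. The choice
    \<open>s = q / (r + 1)\<close> is small enough because \<open>r / (r + 1) < 2\<close>, and the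
    added 1 covers \<open>r = 0\<close>.\<close>
  have "2 * (q / (r + 1)) * q \<le> (q / (r + 1))\<^sup>2 * r" by (rule ineq)
  moreover have "(q / (r + 1))\<^sup>2 * r < 2 * (q / (r + 1)) * q"
  proof -
    have "q / (r + 1) * q * (r / (r + 1)) < q / (r + 1) * q * 2"
      using q r by (intro mult_strict_left_mono) (auto simp: field_simps)
    then show ?thesis by (simp add: power2_eq_square mult_ac)
  qed
  ultimately show False by simp
qed

lemma mat_eq_zeroI:
  fixes A :: "complex mat"
  assumes A: "A \<in> carrier_mat m n" and z: "\<And>i. i < n \<Longrightarrow> A *\<^sub>v unit_vec n i = 0\<^sub>v m"
  shows "A = 0\<^sub>m m n"
proof (rule eq_matI)
  fix i j assume "i < dim_row (0\<^sub>m m n :: complex mat)" "j < dim_col (0\<^sub>m m n :: complex mat)"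
  then have "A $$ (i, j) = (A *\<^sub>v unit_vec n j) $ i"
    using A by (simp add: mult_mat_unit_vec)
  then show "A $$ (i, j) = 0\<^sub>m m n $$ (i, j)"
    using z[of j] \<open>i < _\<close> \<open>j < _\<close> by simp
qed (use A in auto)

text \<open>The squared norm of a column \<open>A e_i\<close> is the inner product of
  \<open>e_i\<close> with \<open>A A e_i\<close>.\<close>

lemma hermitian_square_zero:
  fixes A :: "complex mat"
  assumes A: "A \<in> carrier_mat n n" and h: "mat_adjoint A = A" and z: "A * A = 0\<^sub>m n n"
  shows "A = 0\<^sub>m n n"
proof (rule mat_eq_zeroI[OF A])
  fix i assume "i < n"
  let ?v = "A *\<^sub>v unit_vec n i"
  have "?v \<bullet>c ?v = unit_vec n i \<bullet>c (A *\<^sub>v ?v)"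
    using cscalar_prod_adjoint[of A n n "unit_vec n i" ?v] A h by simp
  also have "A *\<^sub>v ?v = A * A *\<^sub>v unit_vec n i"
    using A by (simp add: assoc_mult_mat_vec[of _ n n])
  also have "\<dots> = 0\<^sub>v n" unfolding z by (intro eq_vecI) auto
  finally have "?v \<bullet>c ?v = 0" by simp
  then show "?v = 0\<^sub>v n" using A by (simp add: conjugate_square_eq_0_vec[of _ n])
qed

lemma matrix_trace_mult_comm:
  assumes "A \<in> carrier_mat m n" "B \<in> carrier_mat n m"
  shows "matrix_trace (A * B) = matrix_trace (B * A)"
proof -
  have "matrix_trace (A * B) = (\<Sum>i<m. \<Sum>j<n. A $$ (i, j) * B $$ (j, i))"
    using assms by (simp add: matrix_trace_def scalar_prod_def atLeast0LessThan)
  also have "\<dots> = (\<Sum>j<n. \<Sum>i<m. A $$ (i, j) * B $$ (j, i))" by (rule sum.swap)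
  also have "\<dots> = matrix_trace (B * A)"
    using assms by (simp add: matrix_trace_def scalar_prod_def atLeast0LessThan mult.commute)
  finally show ?thesis .
qed

lemma matrix_trace_add:
  assumes "A \<in> carrier_mat n n" "B \<in> carrier_mat n n"
  shows "matrix_trace (A + B) = matrix_trace A + matrix_trace B"
  using assms by (simp add: matrix_trace_def sum.distrib)

lemma matrix_trace_minus:
  assumes "A \<in> carrier_mat n n" "B \<in> carrier_mat n n"
  shows "matrix_trace (A - B) = matrix_trace A - matrix_trace B"
  using assms by (simp add: matrix_trace_def sum_subtractf)

lemma matrix_trace_smult:
  assumes "A \<in> carrier_mat n n"
  shows "matrix_trace (c \<cdot>\<^sub>m A) = c * matrix_trace A"
  using assms by (simp add: matrix_trace_def sum_distrib_left)

lemma matrix_trace_one [simp]: "matrix_trace (1\<^sub>m n) = of_nat n"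
  by (simp add: matrix_trace_def)

text \<open>With \<open>D = B - C\<close> and \<open>S = B + C\<close> one has \<open>D S + S D = 0\<close>, so
  \<open>tr (D S D) = 0\<close>; positivity of \<open>B\<close> and \<open>C\<close> then gives
  \<open>B D = C D = 0\<close>, whence \<open>D D = 0\<close>.\<close>

lemma psd_sqrt_unique:
  assumes B: "psd n B" and C: "psd n C" and eq: "B * B = C * C"
  shows "B = C"
proof -
  have cB: "B \<in> carrier_mat n n" and hB: "mat_adjoint B = B"
    and cC: "C \<in> carrier_mat n n" and hC: "mat_adjoint C = C"
    using B C by (auto simp: psd_def)
  define D where "D = B - C"
  have cD: "D \<in> carrier_mat n n" unfolding D_def by (rule minus_carrier_mat[OF cC])
  have hD: "mat_adjoint D = D" using cB cC hB hC by (simp add: D_def mat_adjoint_minus[of _ n n])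
  note c = cB cC cD
  define S where "S = B + C"
  have cS: "S \<in> carrier_mat n n" using c by (simp add: S_def)
  have "D * S = (B * B - C * B) + (B * C - C * C)"
    using c by (simp add: D_def S_def minus_mult_distrib_mat[of _ n n] mult_add_distrib_mat[of _ n n])
  moreover have "S * D = (B * B + C * B) - (B * C + C * C)"
    using c by (simp add: D_def S_def add_mult_distrib_mat[of _ n n] mult_minus_distrib_mat[of _ n n])
  ultimately have "D * S = - (S * D)"
    using c unfolding eq by (intro eq_matI) (auto simp del: index_mult_mat(1))
  then have "D * S * D = - (S * D) * D" by simp
  also have "\<dots> = - (S * (D * D))"
    using cS cD by (simp add: assoc_mult_mat[of _ n n _ n _ n])
  finally have "matrix_trace (D * S * D) = - matrix_trace (S * (D * D))"
    using cS cD by (simp add: matrix_trace_def sum_negf del: index_mult_mat(1))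
  moreover have "matrix_trace (D * S * D) = matrix_trace (S * (D * D))"
    using matrix_trace_mult_comm[of D n n "S * D"] cS cD by (simp add: assoc_mult_mat[of _ n n _ n _ n])
  ultimately have tr: "matrix_trace (D * S * D) = 0" by simp
  \<comment> \<open>Since \<open>D\<close> is Hermitian, a diagonal entry of \<open>D S D\<close> is
    the form of \<open>S\<close> at \<open>D e_i\<close>. The vanishing trace is thus a sum of
    nonnegative forms of \<open>B\<close> and \<open>C\<close>, each of which must be zero.\<close>
  have form: "(D * S * D) $$ (i, i) = (B *\<^sub>v (D *\<^sub>v unit_vec n i)) \<bullet>c (D *\<^sub>v unit_vec n i)
      + (C *\<^sub>v (D *\<^sub>v unit_vec n i)) \<bullet>c (D *\<^sub>v unit_vec n i)" if "i < n" for i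
  proof -
    let ?v = "D *\<^sub>v unit_vec n i"
    have v: "?v \<in> carrier_vec n" using cD by simp
    have cu: "conjugate (unit_vec n i) = (unit_vec n i :: complex vec)"
      by (rule eq_vecI) (auto simp: unit_vec_def)
    have "(B *\<^sub>v ?v) \<bullet>c ?v + (C *\<^sub>v ?v) \<bullet>c ?v = (S *\<^sub>v ?v) \<bullet>c ?v"
      using c v by (simp add: S_def add_mult_distrib_mat_vec[of _ n n] add_scalar_prod_distrib[of _ n])
    also have "\<dots> = (D *\<^sub>v (S *\<^sub>v ?v)) \<bullet>c unit_vec n i"
      using cscalar_prod_adjoint[of D n n "S *\<^sub>v ?v" "unit_vec n i"] hD cD cS v by simp
    also have "\<dots> = (D * S * D *\<^sub>v unit_vec n i) \<bullet> unit_vec n i"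
      using cD cS by (simp add: assoc_mult_mat_vec[of _ n n _ n] assoc_mult_mat[of _ n n _ n _ n] cu)
    also have "\<dots> = (D * S * D) $$ (i, i)"
      using cD cS that by (simp add: scalar_prod_right_unit mult_mat_unit_vec[of _ n] del: index_mult_mat(1))
    finally show ?thesis by simp
  qed
  have vv: "D *\<^sub>v unit_vec n i \<in> carrier_vec n" for i using cD by simp
  have nn: "0 \<le> Re ((B *\<^sub>v (D *\<^sub>v unit_vec n i)) \<bullet>c (D *\<^sub>v unit_vec n i))"
           "0 \<le> Re ((C *\<^sub>v (D *\<^sub>v unit_vec n i)) \<bullet>c (D *\<^sub>v unit_vec n i))" for i
    using B C vv[of i] by (auto simp: psd_def)
  have "(\<Sum>i<n. Re ((D * S * D) $$ (i, i))) = 0"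
    using tr cD by (simp add: matrix_trace_def del: index_mult_mat(1) flip: Re_sum)
  then have "\<forall>i<n. Re ((D * S * D) $$ (i, i)) = 0"
    by (subst (asm) sum_nonneg_eq_0_iff) (use nn in \<open>auto simp: form simp del: index_mult_mat(1)\<close>)
  then have z: "Re ((B *\<^sub>v (D *\<^sub>v unit_vec n i)) \<bullet>c (D *\<^sub>v unit_vec n i)) = 0"
      "Re ((C *\<^sub>v (D *\<^sub>v unit_vec n i)) \<bullet>c (D *\<^sub>v unit_vec n i)) = 0" if "i < n" for i
    using that nn[of i] form[OF that] by (smt (verit) plus_complex.sel(1))+
  have "D * D = 0\<^sub>m n n"
  proof (rule mat_eq_zeroI)
    fix i assume i: "i < n"
    have "D * D *\<^sub>v unit_vec n i = D *\<^sub>v (D *\<^sub>v unit_vec n i)"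
      using cD by (simp add: assoc_mult_mat_vec[of _ n n])
    also have "\<dots> = B *\<^sub>v (D *\<^sub>v unit_vec n i) - C *\<^sub>v (D *\<^sub>v unit_vec n i)"
      using minus_mult_distrib_mat_vec[OF cB cC vv[of i]] by (simp add: D_def)
    also have "\<dots> = 0\<^sub>v n"
      using psd_form_zero[OF B vv z(1)[OF i]] psd_form_zero[OF C vv z(2)[OF i]] by simp
    finally show "D * D *\<^sub>v unit_vec n i = 0\<^sub>v n" .
  qed (use cD in simp)
  then have "D = 0\<^sub>m n n" by (rule hermitian_square_zero[OF cD hD])
  then have *: "(B - C) $$ (i, j) = 0" if "i < n" "j < n" for i j using that by (simp add: D_def)
  show ?thesis
  proof (rule eq_matI)
    fix i j assume "i < dim_row C" "j < dim_col C"
    then show "B $$ (i, j) = C $$ (i, j)" using *[of i j] c by simp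
  qed (use c in auto)
qed

text \<open>The exhibited \<open>B\<close> supplies existence for the definite description, and
  \<open>psd_sqrt_unique\<close> supplies uniqueness.\<close>

lemma mat_abs_eqI:
  assumes "A \<in> carrier_mat n n" "psd n B" "B * B = mat_adjoint A * A"
  shows "mat_abs A = B"
  unfolding mat_abs_def using assms psd_sqrt_unique by (intro the_equality) auto

text \<open>Later \<open>c = 2 t / d^2\<close> with \<open>t\<close> of either sign; the modulus
  taken here is the source of \<open>|t|\<close> in both discord formulas.\<close>

lemma trace_norm_smult:
  assumes A: "A \<in> carrier_mat n n" and B: "psd n B" and sq: "B * B = mat_adjoint A * A"
  shows "trace_norm (complex_of_real c \<cdot>\<^sub>m A) = \<bar>c\<bar> * Re (matrix_trace B)"
proof -
  have cB: "B \<in> carrier_mat n n" using B by (simp add: psd_def)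
  have "mat_abs (complex_of_real c \<cdot>\<^sub>m A) = complex_of_real \<bar>c\<bar> \<cdot>\<^sub>m B"
  proof (rule mat_abs_eqI[of _ n])
    have "complex_of_real \<bar>c\<bar> * complex_of_real \<bar>c\<bar> = complex_of_real c * complex_of_real c"
      by (simp flip: of_real_mult)
    then show "complex_of_real \<bar>c\<bar> \<cdot>\<^sub>m B * (complex_of_real \<bar>c\<bar> \<cdot>\<^sub>m B) =
        mat_adjoint (complex_of_real c \<cdot>\<^sub>m A) * (complex_of_real c \<cdot>\<^sub>m A)"
      using A cB sq
      by (simp add: mat_adjoint_smult mult_smult_distrib[of _ n n _ n] mult_smult_assoc_mat[of _ n n _ n]
          smult_smult_mat)
  qed (use A psd_smult[OF B] in auto)
  then show ?thesis
    using cB by (simp add: trace_norm_def matrix_trace_smult[of _ n])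
qed

section \<open>Eigenvalue criteria and sums of matrices\<close>

text \<open>Every column of \<open>A\<close> satisfies the eigenvector equation of \<open>M\<close>
  for \<open>c\<close>, and some column is nonzero. Eigenvectors can so be supplied as a whole
  matrix, without choosing one.\<close>

lemma psd_eigenvalue_nonneg:
  assumes M: "psd n M" and A: "A \<in> carrier_mat n n" "A \<noteq> 0\<^sub>m n n"
    and eq: "M * A = complex_of_real c \<cdot>\<^sub>m A"
  shows "0 \<le> c"
proof -
  have cM: "M \<in> carrier_mat n n" using M by (simp add: psd_def)
  from A mat_eq_zeroI[of A n n] obtain i where i: "i < n" and ne: "A *\<^sub>v unit_vec n i \<noteq> 0\<^sub>v n"
    by blast
  let ?w = "A *\<^sub>v unit_vec n i"
  have w: "?w \<in> carrier_vec n" using A by simp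
  have "M *\<^sub>v ?w = complex_of_real c \<cdot>\<^sub>v ?w"
    using assoc_mult_mat_vec[OF cM A(1), of "unit_vec n i"] A
    by (simp add: eq smult_mat_mult_vec[of _ n n])
  then have "(M *\<^sub>v ?w) \<bullet>c ?w = complex_of_real c * (?w \<bullet>c ?w)"
    using w by (simp add: smult_scalar_prod_distrib[of _ n])
  moreover have "0 \<le> Re ((M *\<^sub>v ?w) \<bullet>c ?w)" using M w by (simp add: psd_def)
  moreover define r where "r = (\<Sum>i<dim_vec ?w. (cmod (?w $ i))\<^sup>2)"
  ultimately have "0 \<le> c * r" unfolding cscalar_prod_self r_def by simp
  moreover have "r \<noteq> 0"
    using ne w cscalar_prod_self[of ?w] unfolding r_def
    by (metis conjugate_square_eq_0_vec of_real_0)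
  moreover have "0 \<le> r" by (simp add: r_def sum_nonneg)
  ultimately show ?thesis by (simp add: zero_le_mult_iff)
qed

text \<open>Multiplication of linear polynomials modulo the quadratic relation of
  \<open>X\<close>.\<close>

lemma affine_mat_mult:
  fixes X :: "complex mat"
  assumes X: "X \<in> carrier_mat n n" and sq: "X * X = s \<cdot>\<^sub>m 1\<^sub>m n + r \<cdot>\<^sub>m X"
  shows "(a \<cdot>\<^sub>m 1\<^sub>m n + b \<cdot>\<^sub>m X) * (c \<cdot>\<^sub>m 1\<^sub>m n + e \<cdot>\<^sub>m X) =
    (a * c + b * e * s) \<cdot>\<^sub>m 1\<^sub>m n + (a * e + b * c + b * e * r) \<cdot>\<^sub>m X"
proof -
  have "(a \<cdot>\<^sub>m 1\<^sub>m n + b \<cdot>\<^sub>m X) * (c \<cdot>\<^sub>m 1\<^sub>m n + e \<cdot>\<^sub>m X) =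
      c \<cdot>\<^sub>m (a \<cdot>\<^sub>m 1\<^sub>m n + b \<cdot>\<^sub>m X) + e \<cdot>\<^sub>m (a \<cdot>\<^sub>m X + b \<cdot>\<^sub>m (X * X))"
    using X by (simp add: add_mult_distrib_mat[of _ n n _ _ n] mult_add_distrib_mat[of _ n n _ n]
        mult_smult_distrib[of _ n n _ n] mult_smult_assoc_mat[of _ n n _ n])
  also have "\<dots> = (a * c + b * e * s) \<cdot>\<^sub>m 1\<^sub>m n + (a * e + b * c + b * e * r) \<cdot>\<^sub>m X"
    unfolding sq using X by (intro eq_matI) (auto simp: algebra_simps)
  finally show ?thesis .
qed

text \<open>The relation \<open>sq\<close> is \<open>(X - p) (X - q) = 0\<close>. Up to the factor
  \<open>q - p\<close>, the matrices \<open>X - p\<close> and \<open>q - X\<close> are therefore the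
  spectral projections for \<open>q\<close> and \<open>p\<close>. The trace conditions say that
  neither vanishes, so both eigenvalues occur and both inequalities are necessary.\<close>

lemma psd_two_eigenvalues:
  fixes p q a b :: real
  assumes X: "X \<in> carrier_mat n n" and h: "mat_adjoint X = X" and pq: "p < q"
    and sq: "X * X = complex_of_real (- p * q) \<cdot>\<^sub>m 1\<^sub>m n + complex_of_real (p + q) \<cdot>\<^sub>m X"
    and tr: "matrix_trace X \<noteq> complex_of_real (p * real n)" "matrix_trace X \<noteq> complex_of_real (q * real n)"
  shows "psd n (complex_of_real a \<cdot>\<^sub>m 1\<^sub>m n + complex_of_real b \<cdot>\<^sub>m X) \<longleftrightarrow> 0 \<le> a + b * p \<and> 0 \<le> a + b * q"
proof -
  define L where "L a b = complex_of_real a \<cdot>\<^sub>m 1\<^sub>m n + complex_of_real b \<cdot>\<^sub>m X" for a b :: real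
  have cL: "L a b \<in> carrier_mat n n" for a b using X by (simp add: L_def)
  have hL: "mat_adjoint (L a b) = L a b" for a b
    using X h by (simp add: L_def mat_adjoint_add[of _ n n] mat_adjoint_smult)
  have mult: "L a b * L c e = L (a * c - b * e * p * q) (a * e + b * c + b * e * (p + q))" for a b c e
    unfolding L_def affine_mat_mult[OF X sq] by (simp add: mult.assoc)
  have smult: "complex_of_real c \<cdot>\<^sub>m L a b = L (c * a) (c * b)" for a b c
    using X by (intro eq_matI) (auto simp: L_def algebra_simps)
  have add: "L a b + L c e = L (a + c) (b + e)" for a b c e
    using X by (intro eq_matI) (auto simp: L_def algebra_simps)
  have trL: "matrix_trace (L a b) = of_real (a * real n) + of_real b * matrix_trace X" for a b
    using X by (simp add: L_def matrix_trace_add[of _ n] matrix_trace_smult[of _ n])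
  have "L (- p) 1 * L (- p) 1 = complex_of_real (q - p) \<cdot>\<^sub>m L (- p) 1"
    "L q (- 1) * L q (- 1) = complex_of_real (q - p) \<cdot>\<^sub>m L q (- 1)"
    unfolding mult smult by (simp_all add: algebra_simps)
  then have psd: "psd n (L (- p) 1)" "psd n (L q (- 1))"
    using psd_hermitian_square[OF cL hL, where c = "q - p"] pq by (simp_all del: of_real_diff)
  have ne: "L (- p) 1 \<noteq> 0\<^sub>m n n" "L q (- 1) \<noteq> 0\<^sub>m n n"
    using tr trL[of "-p" 1] trL[of q "-1"] by (auto simp: matrix_trace_def[of "0\<^sub>m n n"])
  \<comment> \<open>The columns of \<open>X - p\<close> lie in the eigenspace for \<open>q\<close>,
    those of \<open>q - X\<close> in the one for \<open>p\<close>; hence the crossed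
    pairing.\<close>
  have "L a b * L (- p) 1 = complex_of_real (a + b * q) \<cdot>\<^sub>m L (- p) 1"
    "L a b * L q (- 1) = complex_of_real (a + b * p) \<cdot>\<^sub>m L q (- 1)"
    unfolding mult smult by (simp_all add: algebra_simps)
  then have "0 \<le> a + b * p \<and> 0 \<le> a + b * q" if "psd n (L a b)"
    using psd_eigenvalue_nonneg[OF that cL ne(1)] psd_eigenvalue_nonneg[OF that cL ne(2)] by blast
  moreover have "psd n (L a b)" if "0 \<le> a + b * p" "0 \<le> a + b * q"
  proof -
    \<comment> \<open>Lagrange interpolation of \<open>a + b X\<close> at the nodes \<open>p\<close>
      and \<open>q\<close>: a combination of two positive matrices whose weights are the eigenvalues
      divided by \<open>q - p\<close>.\<close>
    have "L a b = complex_of_real ((a + b * q) / (q - p)) \<cdot>\<^sub>m L (- p) 1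
        + complex_of_real ((a + b * p) / (q - p)) \<cdot>\<^sub>m L q (- 1)"
      unfolding smult add using pq
      by (intro arg_cong2[of _ _ _ _ L]) (simp_all add: divide_simps, simp_all add: algebra_simps)
    then show ?thesis
      using that pq by (simp only:) (intro psd_add psd_smult psd divide_nonneg_pos, auto)
  qed
  ultimately show ?thesis unfolding L_def by blast
qed

section \<open>Finite sums of matrices: products, adjoints, traces, orthogonal idempotents\<close>

lemma matrix_sum_carrier [simp]: "matrix_sum nr nc A I \<in> carrier_mat nr nc"
  by (simp add: matrix_sum_def)

lemma matrix_sum_index [simp]:
  "i < nr \<Longrightarrow> j < nc \<Longrightarrow> matrix_sum nr nc A I $$ (i, j) = (\<Sum>k\<in>I. A k $$ (i, j))"
  by (simp add: matrix_sum_def)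

lemma matrix_sum_dim [simp]:
  "dim_row (matrix_sum nr nc A I) = nr" "dim_col (matrix_sum nr nc A I) = nc"
  by (simp_all add: matrix_sum_def)

lemma matrix_sum_cong:
  "(\<And>k. k \<in> I \<Longrightarrow> A k = B k) \<Longrightarrow> matrix_sum nr nc A I = matrix_sum nr nc B I"
  by (simp add: matrix_sum_def)

lemma matrix_sum_mult_right:
  assumes B: "B \<in> carrier_mat n m" and A: "\<And>k. k \<in> I \<Longrightarrow> A k \<in> carrier_mat l n"
  shows "matrix_sum l n A I * B = matrix_sum l m (\<lambda>k. A k * B) I"
proof (rule eq_matI)
  fix i j assume "i < dim_row (matrix_sum l m (\<lambda>k. A k * B) I)" "j < dim_col (matrix_sum l m (\<lambda>k. A k * B) I)"
  then have ij: "i < l" "j < m" by auto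
  have "(matrix_sum l n A I * B) $$ (i, j) = (\<Sum>x<n. \<Sum>k\<in>I. A k $$ (i, x) * B $$ (x, j))"
    using ij B by (simp add: scalar_prod_def atLeast0LessThan sum_distrib_right)
  also have "\<dots> = (\<Sum>k\<in>I. \<Sum>x<n. A k $$ (i, x) * B $$ (x, j))" by (rule sum.swap)
  also have "\<dots> = (\<Sum>k\<in>I. (A k * B) $$ (i, j))"
    using ij B A[THEN carrier_matD(1)] A[THEN carrier_matD(2)]
    by (intro sum.cong) (simp_all add: scalar_prod_def atLeast0LessThan)
  finally show "(matrix_sum l n A I * B) $$ (i, j) = matrix_sum l m (\<lambda>k. A k * B) I $$ (i, j)"
    using ij by (simp del: index_mult_mat(1))
qed (use B in auto)

lemma matrix_sum_mult_left:
  assumes B: "B \<in> carrier_mat l n" and A: "\<And>k. k \<in> I \<Longrightarrow> A k \<in> carrier_mat n m"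
  shows "B * matrix_sum n m A I = matrix_sum l m (\<lambda>k. B * A k) I"
proof (rule eq_matI)
  fix i j assume "i < dim_row (matrix_sum l m (\<lambda>k. B * A k) I)" "j < dim_col (matrix_sum l m (\<lambda>k. B * A k) I)"
  then have ij: "i < l" "j < m" by auto
  have "(B * matrix_sum n m A I) $$ (i, j) = (\<Sum>x<n. \<Sum>k\<in>I. B $$ (i, x) * A k $$ (x, j))"
    using ij B by (simp add: scalar_prod_def atLeast0LessThan sum_distrib_left)
  also have "\<dots> = (\<Sum>k\<in>I. \<Sum>x<n. B $$ (i, x) * A k $$ (x, j))" by (rule sum.swap)
  also have "\<dots> = (\<Sum>k\<in>I. (B * A k) $$ (i, j))"
    using ij B A[THEN carrier_matD(1)] A[THEN carrier_matD(2)]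
    by (intro sum.cong) (simp_all add: scalar_prod_def atLeast0LessThan)
  finally show "(B * matrix_sum n m A I) $$ (i, j) = matrix_sum l m (\<lambda>k. B * A k) I $$ (i, j)"
    using ij by (simp del: index_mult_mat(1))
qed (use B in auto)

lemma mat_adjoint_matrix_sum:
  assumes "\<And>k. k \<in> I \<Longrightarrow> A k \<in> carrier_mat n m"
  shows "mat_adjoint (matrix_sum n m A I) = matrix_sum m n (\<lambda>k. mat_adjoint (A k)) I"
  by (rule eq_matI) (use assms[THEN carrier_matD(1)] assms[THEN carrier_matD(2)] in
      \<open>auto simp: conjugate_complex_def intro!: sum.cong\<close>)

lemma matrix_trace_matrix_sum:
  assumes "\<And>k. k \<in> I \<Longrightarrow> A k \<in> carrier_mat n n"
  shows "matrix_trace (matrix_sum n n A I) = (\<Sum>k\<in>I. matrix_trace (A k))"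
proof -
  have "matrix_trace (matrix_sum n n A I) = (\<Sum>k\<in>I. \<Sum>i<n. A k $$ (i, i))"
    by (simp add: matrix_trace_def sum.swap[of _ I])
  also have "\<dots> = (\<Sum>k\<in>I. matrix_trace (A k))"
    using assms[THEN carrier_matD(1)] by (intro sum.cong) (simp_all add: matrix_trace_def)
  finally show ?thesis .
qed

text \<open>Used for the measured entangled operator, with summands \<open>Q k * X * Q k\<close>,
  and for the projection \<open>R\<close> of the flip case, with summands
  \<open>M k\<close>.\<close>

lemma matrix_sum_mult_orthogonal:
  assumes I: "finite I" and A: "\<And>k. k \<in> I \<Longrightarrow> A k \<in> carrier_mat n n"
    and id: "\<And>k. k \<in> I \<Longrightarrow> A k * A k = A k"
    and orth: "\<And>j k. j \<in> I \<Longrightarrow> k \<in> I \<Longrightarrow> j \<noteq> k \<Longrightarrow> A j * A k = 0\<^sub>m n n"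
  shows "matrix_sum n n A I * matrix_sum n n A I = matrix_sum n n A I"
proof -
  have "A k * matrix_sum n n A I = A k" if k: "k \<in> I" for k
  proof -
    have "A k * matrix_sum n n A I = matrix_sum n n (\<lambda>j. A k * A j) I"
      by (rule matrix_sum_mult_left) (use A k in auto)
    also have "\<dots> = matrix_sum n n (\<lambda>j. if j = k then A k else 0\<^sub>m n n) I"
      by (rule matrix_sum_cong) (use id orth k in auto)
    also have "\<dots> = A k"
    proof (rule eq_matI)
      fix i j assume "i < dim_row (A k)" "j < dim_col (A k)"
      then have ij: "i < n" "j < n" using A[OF k] by auto
      have "(\<Sum>l\<in>I. (if l = k then A k else 0\<^sub>m n n) $$ (i, j)) = (\<Sum>l\<in>I. if l = k then A k $$ (i, j) else 0)"
        using ij by (intro sum.cong) auto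
      then show "matrix_sum n n (\<lambda>j. if j = k then A k else 0\<^sub>m n n) I $$ (i, j) = A k $$ (i, j)"
        using ij I k by simp
    qed (use A[OF k] in auto)
    finally show ?thesis .
  qed
  moreover have "matrix_sum n n A I * matrix_sum n n A I = matrix_sum n n (\<lambda>k. A k * matrix_sum n n A I) I"
    by (rule matrix_sum_mult_right) (use A in auto)
  ultimately show ?thesis using matrix_sum_cong[of I "\<lambda>k. A k * matrix_sum n n A I" A n n] by simp
qed

section \<open>Completeness of the generators\<close>

lemma mat_unit_index [simp]:
  "x < d \<Longrightarrow> y < d \<Longrightarrow> mat_unit d j k $$ (x, y) = of_bool (Suc x = j \<and> Suc y = k)"
  by (simp add: mat_unit_def)

lemma mat_unit_dim [simp]: "dim_row (mat_unit d j k) = d" "dim_col (mat_unit d j k) = d"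
  by (simp_all add: mat_unit_def)

text \<open>Zero-based form: \<open>K\<close> stands for \<open>k - 1\<close>, so block
  \<open>K\<close> consists of the labels from \<open>K^2\<close> to \<open>K^2 + 2 K\<close>, the
  last one being the diagonal generator.\<close>

lemma gell_mann_sym_index:
  assumes "K < d" "j < K" "x < d" "y < d"
  shows "gell_mann d (K\<^sup>2 + 2 * j) $$ (x, y) = of_bool (x = j \<and> y = K) + of_bool (x = K \<and> y = j)"
  using gell_mann_sym[of "Suc K" d "Suc j"] assms by simp

lemma gell_mann_antisym_index:
  assumes "K < d" "j < K" "x < d" "y < d"
  shows "gell_mann d (K\<^sup>2 + 2 * j + 1) $$ (x, y) =
    - \<i> * of_bool (x = j \<and> y = K) + \<i> * of_bool (x = K \<and> y = j)"
  using gell_mann_antisym[of "Suc K" d "Suc j"] assms by (simp add: algebra_simps)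

lemma gell_mann_diagonal_index:
  assumes "0 < K" "K < d" "x < d" "y < d"
  shows "gell_mann d (K\<^sup>2 + 2 * K) $$ (x, y) =
    of_bool (x = y) * (complex_of_real (sqrt (2 / (real K * real (Suc K)))) *
      (if x < K then 1 else if x = K then - of_nat K else 0))"
proof -
  have "(Suc K)\<^sup>2 - 1 = K\<^sup>2 + 2 * K" by (simp add: power2_eq_square)
  then show ?thesis
    using gell_mann_diagonal[of "Suc K" d] assms
    by (simp add: gell_mann_diag_def mat_diag_def mult.commute)
qed

lemma gell_mann_dim [simp]: "dim_row (gell_mann d l) = d" "dim_col (gell_mann d l) = d"
  by (simp_all add: gell_mann_def gell_mann_diag_def Let_def mat_diag_def)

lemma gell_mann_carrier [simp]: "gell_mann d l \<in> carrier_mat d d"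
  by (intro carrier_matI) simp_all

text \<open>With \<open>K = floor_sqrt l\<close> the offset \<open>l - K^2\<close> is at most
  \<open>2 K\<close>; its maximal value marks the diagonal generator and otherwise its parity
  separates symmetric from antisymmetric. \<open>0 < l\<close> excludes the empty block
  \<open>K = 0\<close>.\<close>

lemma gell_mann_cases [consumes 2, case_names sym antisym diag]:
  fixes l d :: nat
  assumes "0 < l" "l < d\<^sup>2"
  obtains K j where "K < d" "j < K" "l = K\<^sup>2 + 2 * j"
  | K j where "K < d" "j < K" "l = K\<^sup>2 + 2 * j + 1"
  | K where "0 < K" "K < d" "l = K\<^sup>2 + 2 * K"
proof -
  define K where "K = floor_sqrt l"
  have le: "K\<^sup>2 \<le> l" by (simp add: K_def)
  have "l < (Suc K)\<^sup>2" by (simp add: K_def Suc_floor_sqrt_power2_gt)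
  then obtain r where r: "l = K\<^sup>2 + r" "r \<le> 2 * K"
    using le by (auto simp: power2_eq_square dest!: le_Suc_ex)
  have K0: "0 < K" using r assms(1) by (cases K) auto
  have Kd: "K < d"
  proof (rule ccontr)
    assume "\<not> K < d"
    then have "d\<^sup>2 \<le> K\<^sup>2" by (intro power_mono) auto
    then show False using le assms(2) by linarith
  qed
  consider "r = 2 * K" | "r \<noteq> 2 * K" "even r" | "odd r" by blast
  then show thesis
  proof cases
    case 1
    then show ?thesis using that(3) r K0 Kd by blast
  next
    case 2
    then obtain j where "r = 2 * j" by blast
    then show ?thesis using that(1)[of K j] r 2 Kd by simp
  next
    case 3
    then obtain j where "r = 2 * j + 1" by (elim oddE)
    then show ?thesis using that(2)[of K j] r Kd by simp
  qed
qed

lemma sum_pairs: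
  fixes f :: "nat \<Rightarrow> 'a::comm_monoid_add"
  shows "sum f {m..<m + 2 * K} = (\<Sum>j<K. f (m + 2 * j) + f (m + 2 * j + 1))"
  by (induction K) (simp_all add: sum.atLeastLessThan_Suc add.assoc)

text \<open>The labels below \<open>K^2\<close> are the generators of su(K) placed in the upper left
  corner. Completeness therefore holds in every intermediate dimension, with \<open>K\<close> in
  place of \<open>d\<close>, and block \<open>K\<close> has to account exactly for the passage from
  \<open>K\<close> to \<open>K + 1\<close>.\<close>

lemma gell_mann_partial_completeness:
  assumes "1 \<le> K" "K \<le> d" "x < d" "y < d" "b < d" "e < d"
  shows "(\<Sum>l\<in>{1..<K\<^sup>2}. gell_mann d l $$ (x, y) * gell_mann d l $$ (b, e)) =
    2 * (of_bool (x = e \<and> y = b \<and> x < K \<and> y < K) - of_bool (x = y \<and> b = e \<and> x < K \<and> b < K) / of_nat K)"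
  using assms(1,2)
proof (induction K rule: dec_induct)
  case base
  then show ?case by auto
next
  case (step K)
  let ?f = "\<lambda>l. gell_mann d l $$ (x, y) * gell_mann d l $$ (b, e)"
  have K: "0 < K" "K < d" using step by auto
  have split: "sum ?f {1..<(Suc K)\<^sup>2} = sum ?f {1..<K\<^sup>2} + sum ?f {K\<^sup>2..<K\<^sup>2 + 2 * K} + ?f (K\<^sup>2 + 2 * K)"
  proof -
    have "(Suc K)\<^sup>2 = Suc (K\<^sup>2 + 2 * K)" by (simp add: power2_eq_square)
    then have "sum ?f {1..<(Suc K)\<^sup>2} = sum ?f {1..<K\<^sup>2 + 2 * K} + ?f (K\<^sup>2 + 2 * K)"
      using K by (simp add: sum.atLeastLessThan_Suc)
    also have "sum ?f {1..<K\<^sup>2 + 2 * K} = sum ?f {1..<K\<^sup>2} + sum ?f {K\<^sup>2..<K\<^sup>2 + 2 * K}"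
      using K by (intro sum.atLeastLessThan_concat[symmetric]) auto
    finally show ?thesis .
  qed
  \<comment> \<open>Adding the contribution of a symmetric generator to that of its antisymmetric
    partner cancels \<open>p * p'\<close> and \<open>q * q'\<close> and leaves only the flip
    terms.\<close>
  have pair: "(p + q) * (p' + q') + (- \<i> * p + \<i> * q) * (- \<i> * p' + \<i> * q') = 2 * (p * q') + 2 * (q * p')"
    for p q p' q' :: complex by (simp add: algebra_simps)
  have "sum ?f {K\<^sup>2..<K\<^sup>2 + 2 * K} = (\<Sum>j<K. ?f (K\<^sup>2 + 2 * j) + ?f (K\<^sup>2 + 2 * j + 1))"
    by (rule sum_pairs)
  also have "\<dots> = (\<Sum>j<K. (if j = x then 2 * of_bool (y = K \<and> b = K \<and> e = x) else 0)
      + (if j = y then 2 * of_bool (x = K \<and> e = K \<and> b = y) else 0))"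
  proof (rule sum.cong[OF refl])
    fix j assume "j \<in> {..<K}"
    then have j: "j < K" by simp
    show "?f (K\<^sup>2 + 2 * j) + ?f (K\<^sup>2 + 2 * j + 1) =
        (if j = x then 2 * of_bool (y = K \<and> b = K \<and> e = x) else 0)
      + (if j = y then 2 * of_bool (x = K \<and> e = K \<and> b = y) else 0)"
      unfolding gell_mann_sym_index[OF K(2) j assms(3,4)] gell_mann_sym_index[OF K(2) j assms(5,6)]
        gell_mann_antisym_index[OF K(2) j assms(3,4)] gell_mann_antisym_index[OF K(2) j assms(5,6)] pair
      using j by (auto simp: of_bool_def)
  qed
  also have "\<dots> = 2 * of_bool (x < K \<and> y = K \<and> b = K \<and> e = x) + 2 * of_bool (y < K \<and> x = K \<and> e = K \<and> b = y)"
    by (auto simp: sum.distrib)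
  finally have mid: "sum ?f {K\<^sup>2..<K\<^sup>2 + 2 * K} = \<dots>" .
  define g where "g z = (if z < K then 1 else if z = K then - of_nat K else (0::complex))" for z
  have "sqrt (2 / (real K * real (Suc K))) * sqrt (2 / (real K * real (Suc K))) = 2 / (real K * real (Suc K))"
    by simp
  then have sq: "complex_of_real (sqrt (2 / (real K * real (Suc K)))) * complex_of_real (sqrt (2 / (real K * real (Suc K))))
      = 2 / (of_nat K * of_nat (Suc K))"
    unfolding of_real_mult[symmetric] by simp
  have "?f (K\<^sup>2 + 2 * K) = of_bool (x = y) * of_bool (b = e) *
      (complex_of_real (sqrt (2 / (real K * real (Suc K)))) * complex_of_real (sqrt (2 / (real K * real (Suc K))))) * g x * g b"
    unfolding gell_mann_diagonal_index[OF K assms(3,4)] gell_mann_diagonal_index[OF K assms(5,6)] g_def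
    by (simp only: mult_ac)
  then have last: "?f (K\<^sup>2 + 2 * K) = of_bool (x = y \<and> b = e) * (2 / (of_nat K * of_nat (Suc K))) * g x * g b"
    unfolding sq by simp
  have nz: "of_nat K \<noteq> (0::complex)" "1 + of_nat K \<noteq> (0::complex)"
    using K of_nat_Suc[of K, where ?'a=complex] by (simp, metis of_nat_Suc of_nat_eq_0_iff nat.distinct(1))
  \<comment> \<open>Passing to \<open>K + 1\<close>, the flip gains the entries with exactly one of
    \<open>x\<close>, \<open>y\<close> equal to \<open>K\<close>, which the off-diagonal generators
    provide, and the corner where all four indices are \<open>K\<close>, which they do not.\<close>
  have off: "of_bool (x = e \<and> y = b \<and> x < K \<and> y < K) + (of_bool (x < K \<and> y = K \<and> b = K \<and> e = x)
      + of_bool (y < K \<and> x = K \<and> e = K \<and> b = y)) + of_bool (x = K \<and> y = K \<and> b = K \<and> e = K)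
      = (of_bool (x = e \<and> y = b \<and> x < Suc K \<and> y < Suc K) :: complex)"
  proof (cases "x = e \<and> y = b")
    case True
    then have "e = x" "b = y" by auto
    then show ?thesis
      by (cases "x < K"; cases "y < K"; cases "x = K"; cases "y = K"; simp)
  next
    case False
    then have "\<not> (x = e \<and> y = b \<and> x < K \<and> y < K)" "\<not> (x < K \<and> y = K \<and> b = K \<and> e = x)"
      "\<not> (y < K \<and> x = K \<and> e = K \<and> b = y)" "\<not> (x = K \<and> y = K \<and> b = K \<and> e = K)"
      "\<not> (x = e \<and> y = b \<and> x < Suc K \<and> y < Suc K)" by blast+
    then show ?thesis by (simp only: of_bool_eq add_0)
  qed
  \<comment> \<open>The diagonal generator turns \<open>- 1 / K\<close> into
    \<open>- 1 / (K + 1)\<close> and yields the missing corner as well. With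
    \<open>u = 1 / (K (K + 1))\<close>, the product contributes \<open>u\<close>,
    \<open>- u K\<close> or \<open>u K^2\<close>, according to how many of \<open>x\<close> and
    \<open>b\<close> equal \<open>K\<close>.\<close>
  have diag: "- (of_bool (x = y \<and> b = e \<and> x < K \<and> b < K) / of_nat K)
      + of_bool (x = y \<and> b = e) * (1 / (of_nat K * of_nat (Suc K))) * g x * g b
      = of_bool (x = K \<and> y = K \<and> b = K \<and> e = K) - of_bool (x = y \<and> b = e \<and> x < Suc K \<and> b < Suc K) / of_nat (Suc K)"
  proof (cases "x = y \<and> b = e")
    case True
    consider "x < K" | "x = K" | "x > K" by linarith
    moreover consider "b < K" | "b = K" | "b > K" by linarith
    moreover have "1 / (of_nat K * (1 + of_nat K)) = 1 / of_nat K - 1 / (1 + of_nat K :: complex)"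
      "1 / (of_nat K * (1 + of_nat K)) * of_nat K = 1 / (1 + of_nat K :: complex)"
      "1 / (of_nat K * (1 + of_nat K)) * of_nat K * of_nat K = 1 - 1 / (1 + of_nat K :: complex)"
      using nz by (simp_all add: divide_simps) (simp_all add: algebra_simps)?
    ultimately show ?thesis
      using True nz by cases (cases; simp add: g_def less_Suc_eq)+
  qed auto
  \<comment> \<open>\<open>r\<close> is the corner term: missing in \<open>off\<close>, surplus in
    \<open>diag\<close>, so it cancels.\<close>
  have arith: "2 * (p - q) + (2 * m + 2 * m') + c * (2 / k) * u * v = 2 * (p' - q')"
    if "p + (m + m') + r = p'" "- q + c * (1 / k) * u * v = r - q'" for p q m m' c k u v p' q' r :: complex
  proof -
    have "c * (1 / k) * u * v = r - q' + q" using that(2) by (simp add: algebra_simps)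
    moreover have "c * (2 / k) * u * v = 2 * (c * (1 / k) * u * v)" by simp
    ultimately have "c * (2 / k) * u * v = 2 * (r - q' + q)" by (simp only:)
    then show ?thesis unfolding that(1)[symmetric] by (simp add: algebra_simps)
  qed
  show ?case
    unfolding split mid last step.IH[OF less_imp_le[OF K(2)]] by (rule arith[OF off diag])
qed

lemma gell_mann_completeness:
  assumes "0 < d" "x < d" "y < d" "b < d" "e < d"
  shows "(\<Sum>l<d\<^sup>2 - 1. gell_mann d (Suc l) $$ (x, y) * gell_mann d (Suc l) $$ (b, e)) =
    2 * (of_bool (x = e \<and> y = b) - of_bool (x = y \<and> b = e) / of_nat d)"
proof -
  have "(\<Sum>l<d\<^sup>2 - 1. gell_mann d (Suc l) $$ (x, y) * gell_mann d (Suc l) $$ (b, e)) =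
      (\<Sum>l\<in>{1..<d\<^sup>2}. gell_mann d l $$ (x, y) * gell_mann d l $$ (b, e))"
    by (rule sum.reindex_bij_witness[of _ "\<lambda>l. l - 1" Suc]) auto
  then show ?thesis
    using gell_mann_partial_completeness[of d d x y b e] assms by (auto simp: Suc_le_eq)
qed

text \<open>Completeness contracted with coefficient arrays; the right-hand side is
  \<open>2 (tr (A B) - tr A * tr B / d)\<close>. Both families are instances: \<open>A\<close> and
  \<open>B\<close> hold the coefficients with which the two tensor factors depend on the entries of
  a generator.\<close>

lemma gell_mann_bilinear_sum:
  fixes A B :: "nat \<Rightarrow> nat \<Rightarrow> complex"
  assumes "0 < d"
  shows "(\<Sum>l<d\<^sup>2 - 1. (\<Sum>x<d. \<Sum>y<d. A x y * gell_mann d (Suc l) $$ (x, y)) *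
      (\<Sum>z<d. \<Sum>w<d. B z w * gell_mann d (Suc l) $$ (z, w))) =
    2 * ((\<Sum>x<d. \<Sum>y<d. A x y * B y x) - (\<Sum>x<d. A x x) * (\<Sum>z<d. B z z) / of_nat d)"
proof -
  let ?g = "\<lambda>l x y. gell_mann d (Suc l) $$ (x, y)"
  have "(\<Sum>l<d\<^sup>2 - 1. (\<Sum>x<d. \<Sum>y<d. A x y * ?g l x y) * (\<Sum>z<d. \<Sum>w<d. B z w * ?g l z w)) =
      (\<Sum>l<d\<^sup>2 - 1. \<Sum>x<d. \<Sum>y<d. \<Sum>z<d. \<Sum>w<d. A x y * B z w * (?g l x y * ?g l z w))"
    unfolding sum_distrib_right unfolding sum_distrib_left by (simp only: mult_ac)
  also have "\<dots> = (\<Sum>x<d. \<Sum>l<d\<^sup>2 - 1. \<Sum>y<d. \<Sum>z<d. \<Sum>w<d. A x y * B z w * (?g l x y * ?g l z w))"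
    by (rule sum.swap)
  also have "\<dots> = (\<Sum>x<d. \<Sum>y<d. \<Sum>z<d. \<Sum>w<d. \<Sum>l<d\<^sup>2 - 1. A x y * B z w * (?g l x y * ?g l z w))"
    by (rule sum.cong[OF refl], subst sum.swap, rule sum.cong[OF refl], subst sum.swap,
        rule sum.cong[OF refl], rule sum.swap)
  also have "\<dots> = (\<Sum>x<d. \<Sum>y<d. \<Sum>z<d. \<Sum>w<d. A x y * B z w *
      (2 * (of_bool (x = w \<and> y = z) - of_bool (x = y \<and> z = w) / of_nat d)))"
    by (intro sum.cong refl, subst sum_distrib_left[symmetric], subst gell_mann_completeness)
      (use assms in auto)
  also have "\<dots> = (\<Sum>x<d. \<Sum>y<d. \<Sum>z<d. \<Sum>w<d. (if w = x then if z = y then 2 * (A x y * B z w) else 0 else 0)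
      - (if w = z then if y = x then 2 / of_nat d * (A x y * B z w) else 0 else 0))"
    by (intro sum.cong refl) (auto simp: of_bool_def algebra_simps)
  also have "\<dots> = (\<Sum>x<d. \<Sum>y<d. 2 * (A x y * B y x)) - (\<Sum>x<d. \<Sum>z<d. 2 / of_nat d * (A x x * B z z))"
  proof -
    have "(\<Sum>x<d. \<Sum>y<d. \<Sum>z<d. \<Sum>w<d. (if w = x then if z = y then 2 * (A x y * B z w) else 0 else 0)) =
        (\<Sum>x<d. \<Sum>y<d. 2 * (A x y * B y x))"
      by (intro sum.cong refl) simp
    moreover have "(\<Sum>x<d. \<Sum>y<d. \<Sum>z<d. \<Sum>w<d. (if w = z then if y = x then 2 / of_nat d * (A x y * B z w) else 0 else 0)) =
        (\<Sum>x<d. \<Sum>y<d. if y = x then \<Sum>z<d. 2 / of_nat d * (A x y * B z z) else 0)"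
      by (intro sum.cong refl) auto
    ultimately show ?thesis by (simp add: sum_subtractf)
  qed
  also have "\<dots> = 2 * ((\<Sum>x<d. \<Sum>y<d. A x y * B y x) - (\<Sum>x<d. A x x) * (\<Sum>z<d. B z z) / of_nat d)"
  proof -
    have "(\<Sum>x<d. \<Sum>z<d. 2 / of_nat d * (A x x * B z z)) = 2 / of_nat d * ((\<Sum>x<d. A x x) * (\<Sum>z<d. B z z))"
      unfolding sum_product by (simp only: sum_distrib_left)
    then show ?thesis by (simp add: sum_distrib_left[symmetric] right_diff_distrib)
  qed
  finally show ?thesis .
qed

lemma sum_of_bool_pair:
  fixes f :: "nat \<Rightarrow> nat \<Rightarrow> 'a::comm_semiring_1"
  assumes "j < d" "k < d"
  shows "(\<Sum>x<d. \<Sum>y<d. f x y * of_bool (x = j \<and> y = k)) = f j k"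
proof -
  have "(\<Sum>x<d. \<Sum>y<d. f x y * of_bool (x = j \<and> y = k)) =
      (\<Sum>x<d. if x = j then \<Sum>y<d. if y = k then f x y else 0 else 0)"
    by (intro sum.cong refl) (auto intro!: sum.cong)
  then show ?thesis using assms by simp
qed

text \<open>Each generator is symmetric or antisymmetric, so the trace in \<open>I0\<close> is 2 or
  -2 and the diagonal entry of \<open>I0\<close> is exactly its sign under transposition.\<close>

lemma gell_mann_transpose:
  assumes "l < d\<^sup>2 - 1" "x < d" "y < d"
  shows "gell_mann d (Suc l) $$ (y, x) = complex_of_real (I0 d $$ (l, l)) * gell_mann d (Suc l) $$ (x, y)"
proof -
  let ?g = "\<lambda>x y. gell_mann d (Suc l) $$ (x, y)"
  have tr: "matrix_trace (transpose_mat (gell_mann d (Suc l)) * gell_mann d (Suc l)) = (\<Sum>x<d. \<Sum>y<d. ?g y x * ?g y x)"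
    by (simp add: matrix_trace_def scalar_prod_def atLeast0LessThan)
  have I0: "I0 d $$ (l, l) = Re (\<Sum>x<d. \<Sum>y<d. ?g y x * ?g y x) / 2"
    using assms(1) unfolding tr[symmetric] by (simp add: I0_def mat_diag_def)
  \<comment> \<open>Both off-diagonal kinds at once: the weights \<open>1, 1\<close> give 2, the
    weights \<open>- \<i>, \<i>\<close> give -2. The two positions never coincide, as
    \<open>j < K\<close>, so no cross terms arise.\<close>
  have off: "(\<Sum>x<d. \<Sum>y<d. ?g y x * ?g y x) = c\<^sup>2 + c'\<^sup>2"
    if "j < K" "K < d" and eq: "\<And>x y. x < d \<Longrightarrow> y < d \<Longrightarrow> ?g x y = c * of_bool (x = j \<and> y = K) + c' * of_bool (x = K \<and> y = j)"
    for j K c c'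
  proof -
    have "(\<Sum>x<d. \<Sum>y<d. ?g y x * ?g y x) = (\<Sum>x<d. \<Sum>y<d. c\<^sup>2 * of_bool (x = K \<and> y = j) + c'\<^sup>2 * of_bool (x = j \<and> y = K))"
    proof (intro sum.cong refl)
      fix x y assume "x \<in> {..<d}" "y \<in> {..<d}"
      then have g: "?g y x = c * of_bool (x = K \<and> y = j) + c' * of_bool (x = j \<and> y = K)"
        unfolding conj_commute[of "x = _"] by (intro eq) auto
      show "?g y x * ?g y x = c\<^sup>2 * of_bool (x = K \<and> y = j) + c'\<^sup>2 * of_bool (x = j \<and> y = K)"
      proof -
        have "(c * of_bool p + c' * of_bool q) * (c * of_bool p + c' * of_bool q) = c\<^sup>2 * of_bool p + c'\<^sup>2 * of_bool q"
          if "\<not> (p \<and> q)" for p q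
          using that by (cases p; cases q) (simp_all add: power2_eq_square)
        moreover have "\<not> ((x = K \<and> y = j) \<and> (x = j \<and> y = K))" using that(1) by linarith
        ultimately show ?thesis unfolding g .
      qed
    qed
    also have "\<dots> = c\<^sup>2 + c'\<^sup>2"
      using that(1,2) by (simp only: sum.distrib sum_of_bool_pair less_trans[OF that(1,2)])
    finally show ?thesis .
  qed
  have "0 < Suc l" "Suc l < d\<^sup>2" using assms(1) by auto
  then show ?thesis
  proof (cases rule: gell_mann_cases)
    case (sym K j)
    then have eq: "?g x y = 1 * of_bool (x = j \<and> y = K) + 1 * of_bool (x = K \<and> y = j)" if "x < d" "y < d" for x y
      using gell_mann_sym_index[of K d j x y] that by simp
    have "(\<Sum>x<d. \<Sum>y<d. ?g y x * ?g y x) = 1\<^sup>2 + 1\<^sup>2" by (rule off[OF sym(2,1) eq])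
    then have "I0 d $$ (l, l) = 1" by (simp only: I0) simp
    then show ?thesis unfolding eq[OF assms(2,3)] eq[OF assms(3,2)] by (simp add: conj_commute add.commute)
  next
    case (antisym K j)
    then have eq: "?g x y = - \<i> * of_bool (x = j \<and> y = K) + \<i> * of_bool (x = K \<and> y = j)" if "x < d" "y < d" for x y
      using gell_mann_antisym_index[of K d j x y] that by simp
    have "(\<Sum>x<d. \<Sum>y<d. ?g y x * ?g y x) = (- \<i>)\<^sup>2 + \<i>\<^sup>2" by (rule off[OF antisym(2,1) eq])
    then have "I0 d $$ (l, l) = - 1" by (simp only: I0) simp
    then show ?thesis unfolding eq[OF assms(2,3)] eq[OF assms(3,2)] by (simp add: conj_commute add.commute)
  next
    case (diag K)
    define c where "c = sqrt (2 / (real K * real (Suc K)))"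
    have eq: "?g x y = of_bool (x = y) * (complex_of_real c * (if x < K then 1 else if x = K then - of_nat K else 0))"
      if "x < d" "y < d" for x y
      using gell_mann_diagonal_index[OF diag(1,2) that] diag(3) by (simp add: c_def)
    have c2: "c\<^sup>2 = 2 / (real K * real (Suc K))" by (simp add: c_def)
    have "(\<Sum>x<d. \<Sum>y<d. ?g y x * ?g y x) =
        (\<Sum>x<d. \<Sum>y<d. if y = x then complex_of_real (c\<^sup>2 * (if x < K then 1 else if x = K then (real K)\<^sup>2 else 0)) else 0)"
      by (intro sum.cong refl) (auto simp: eq power2_eq_square)
    also have "\<dots> = (\<Sum>x<d. complex_of_real (c\<^sup>2 * (if x < K then 1 else if x = K then (real K)\<^sup>2 else 0)))"
      by simp
    also have "\<dots> = complex_of_real (c\<^sup>2 * (\<Sum>x<d. if x < K then 1 else if x = K then (real K)\<^sup>2 else 0))"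
      by (simp add: sum_distrib_left)
    also have "(\<Sum>x<d. if x < K then 1 else if x = K then (real K)\<^sup>2 else 0) =
        (\<Sum>x<Suc K. if x < K then 1 else if x = K then (real K)\<^sup>2 else 0)"
      using diag(2) by (intro sum.mono_neutral_right) auto
    also have "\<dots> = real K + (real K)\<^sup>2" by simp
    also have "c\<^sup>2 * (real K + (real K)\<^sup>2) = 2"
    proof -
      have "real K + (real K)\<^sup>2 = real K * real (Suc K)" by (simp add: algebra_simps power2_eq_square)
      then show ?thesis unfolding c2 using diag(1) by simp
    qed
    finally have "I0 d $$ (l, l) = 1" unfolding I0 by simp
    then show ?thesis unfolding eq[OF assms(2,3)] eq[OF assms(3,2)] by auto
  qed
qed

section \<open>The two families of states\<close>

lemma gm_comb_carrier [simp]: "gm_comb d n \<in> carrier_mat d d"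
  by (simp add: gm_comb_def)

lemma gm_comb_dim [simp]: "dim_row (gm_comb d n) = d" "dim_col (gm_comb d n) = d"
  by (simp_all add: gm_comb_def)

lemma gm_comb_index:
  assumes "x < d" "y < d"
  shows "gm_comb d n $$ (x, y) = (\<Sum>l<d\<^sup>2 - 1. complex_of_real (n $ l) * gell_mann d (Suc l) $$ (x, y))"
proof -
  have "gm_comb d n $$ (x, y) = (\<Sum>l\<in>{1..d\<^sup>2 - 1}. complex_of_real (n $ (l - 1)) * gell_mann d l $$ (x, y))"
    using assms by (simp add: gm_comb_def)
  also have "\<dots> = (\<Sum>l<d\<^sup>2 - 1. complex_of_real (n $ l) * gell_mann d (Suc l) $$ (x, y))"
    by (rule sum.reindex_bij_witness[of _ Suc "\<lambda>l. l - 1"]) auto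
  finally show ?thesis .
qed

lemma gm_comb_unit_vec:
  assumes "l < d\<^sup>2 - 1"
  shows "gm_comb d (unit_vec (d\<^sup>2 - 1) l) = gell_mann d (Suc l)"
proof (rule eq_matI)
  fix x y assume "x < dim_row (gell_mann d (Suc l))" "y < dim_col (gell_mann d (Suc l))"
  then have xy: "x < d" "y < d" by auto
  have "gm_comb d (unit_vec (d\<^sup>2 - 1) l) $$ (x, y) =
      (\<Sum>m<d\<^sup>2 - 1. if m = l then gell_mann d (Suc m) $$ (x, y) else 0)"
    unfolding gm_comb_index[OF xy] by (intro sum.cong) (use assms in auto)
  then show "gm_comb d (unit_vec (d\<^sup>2 - 1) l) $$ (x, y) = gell_mann d (Suc l) $$ (x, y)"
    using assms by simp
qed auto

lemma gm_comb_smult: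
  assumes "v \<in> carrier_vec (d\<^sup>2 - 1)"
  shows "gm_comb d (c \<cdot>\<^sub>v v) = complex_of_real c \<cdot>\<^sub>m gm_comb d v"
  by (rule eq_matI) (use assms in \<open>auto simp: gm_comb_index sum_distrib_left mult.assoc\<close>)

lemma conjugation_index:
  fixes U M :: "complex mat"
  assumes "U \<in> carrier_mat d d" "M \<in> carrier_mat d d" "a < d" "c < d"
  shows "(U * M * mat_adjoint U) $$ (a, c) =
    (\<Sum>x<d. \<Sum>y<d. U $$ (a, x) * cnj (U $$ (c, y)) * M $$ (x, y))"
proof -
  have "(U * M * mat_adjoint U) $$ (a, c) = (\<Sum>y<d. \<Sum>x<d. U $$ (a, x) * M $$ (x, y) * cnj (U $$ (c, y)))"
    using assms by (simp add: scalar_prod_def atLeast0LessThan sum_distrib_right)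
  also have "\<dots> = (\<Sum>x<d. \<Sum>y<d. U $$ (a, x) * M $$ (x, y) * cnj (U $$ (c, y)))"
    by (rule sum.swap)
  finally show ?thesis by (simp only: mult_ac)
qed

lemma unitary_rows:
  fixes U :: "complex mat"
  assumes "U \<in> carrier_mat d d" "U * mat_adjoint U = 1\<^sub>m d" "a < d" "c < d"
  shows "(\<Sum>x<d. U $$ (a, x) * cnj (U $$ (c, x))) = of_bool (a = c)"
proof -
  have "(U * mat_adjoint U) $$ (a, c) = (\<Sum>x<d. U $$ (a, x) * cnj (U $$ (c, x)))"
    using assms(1,3,4) by (simp add: scalar_prod_def atLeast0LessThan)
  then show ?thesis using assms(3,4) unfolding assms(2) by (cases "a = c") auto
qed

lemma lmm_operator_dim [simp]: "dim_row (lmm_operator d K) = d * d" "dim_col (lmm_operator d K) = d * d"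
  by (simp_all add: lmm_operator_def)

lemma div_mod_eq_iff: "i = j \<longleftrightarrow> i div d = j div d \<and> i mod d = j mod (d::nat)"
  by (metis div_mult_mod_eq)

lemma lmm_operator_index:
  assumes "i < d * d" "j < d * d"
  shows "lmm_operator d K $$ (i, j) = complex_of_real (1 / (real d)\<^sup>2) *
    (of_bool (i = j) + (\<Sum>l<d\<^sup>2 - 1. gm_comb d (K *\<^sub>v unit_vec (d\<^sup>2 - 1) l) $$ (i div d, j div d) *
      gell_mann d (Suc l) $$ (i mod d, j mod d)))"
proof -
  have d: "0 < d" using assms by (cases d) auto
  have lt: "i div d < d" "j div d < d" "i mod d < d" "j mod d < d"
    using assms d by (auto simp: less_mult_imp_div_less)
  have "(\<Sum>l\<in>{1..d\<^sup>2 - 1}. kron (gm_comb d (K *\<^sub>v unit_vec (d\<^sup>2 - 1) (l - 1)))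
          (gm_comb d (unit_vec (d\<^sup>2 - 1) (l - 1))) $$ (i, j)) =
      (\<Sum>l<d\<^sup>2 - 1. kron (gm_comb d (K *\<^sub>v unit_vec (d\<^sup>2 - 1) l))
          (gm_comb d (unit_vec (d\<^sup>2 - 1) l)) $$ (i, j))"
    by (rule sum.reindex_bij_witness[of _ Suc "\<lambda>l. l - 1"]) auto
  also have "\<dots> = (\<Sum>l<d\<^sup>2 - 1. gm_comb d (K *\<^sub>v unit_vec (d\<^sup>2 - 1) l) $$ (i div d, j div d) *
      gell_mann d (Suc l) $$ (i mod d, j mod d))"
    using assms by (intro sum.cong refl) (simp add: kron_def gm_comb_unit_vec del: One_nat_def)
  finally show ?thesis
    using assms lt div_mod_eq_iff[of i j d]
    by (auto simp: lmm_operator_def kron_def)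
qed

text \<open>The flip operator conjugated by \<open>U \<otimes> 1\<close>.\<close>

definition flip_op :: "nat \<Rightarrow> complex mat \<Rightarrow> complex mat" where
  "flip_op d U = mat (d * d) (d * d)
     (\<lambda>(i, j). U $$ (i div d, j mod d) * cnj (U $$ (j div d, i mod d)))"

text \<open>The rank one operator \<open>\<psi> \<psi>\<^sup>*\<close>, where \<open>\<psi>\<close> has the entries of \<open>G\<close> as coordinates.\<close>

definition ent_op :: "nat \<Rightarrow> complex mat \<Rightarrow> complex mat" where
  "ent_op d G = mat (d * d) (d * d)
     (\<lambda>(i, j). G $$ (i div d, i mod d) * cnj (G $$ (j div d, j mod d)))"

lemma flip_op_carrier [simp]: "flip_op d U \<in> carrier_mat (d * d) (d * d)"
  by (simp add: flip_op_def)

lemma ent_op_carrier [simp]: "ent_op d G \<in> carrier_mat (d * d) (d * d)"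
  by (simp add: ent_op_def)

lemma flip_op_dim [simp]: "dim_row (flip_op d U) = d * d" "dim_col (flip_op d U) = d * d"
  by (simp_all add: flip_op_def)

lemma ent_op_dim [simp]: "dim_row (ent_op d G) = d * d" "dim_col (ent_op d G) = d * d"
  by (simp_all add: ent_op_def)

text \<open>By \<open>adjoint_rep\<close> the first tensor factor is \<open>t\<close> times the
  generator conjugated by \<open>U\<close>. The whole sum is thus \<open>2 t (F - 1/d)\<close>
  conjugated by \<open>U\<close> on the first factor, and unitarity fixes the identity part.\<close>

lemma lmm_operator_flip:
  assumes d: "0 < d" and U: "U \<in> carrier_mat d d" "U * mat_adjoint U = 1\<^sub>m d" and V: "adjoint_rep d U V"
  shows "lmm_operator d (t \<cdot>\<^sub>m V) =
    complex_of_real ((1 - 2 * t / real d) / (real d)\<^sup>2) \<cdot>\<^sub>m 1\<^sub>m (d * d) +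
    complex_of_real (2 * t / (real d)\<^sup>2) \<cdot>\<^sub>m flip_op d U"
    (is "?L = ?R")
proof (rule eq_matI)
  fix i j assume "i < dim_row ?R" "j < dim_col ?R"
  then have ij: "i < d * d" "j < d * d" by auto
  have lt: "i div d < d" "j div d < d" "i mod d < d" "j mod d < d"
    using ij d by (auto simp: less_mult_imp_div_less)
  \<comment> \<open>\<open>?A\<close> encodes the entry of a conjugated generator; \<open>?B\<close>
    merely selects one entry of the unconjugated generator in the second factor.\<close>
  let ?A = "\<lambda>x y. U $$ (i div d, x) * cnj (U $$ (j div d, y))"
  let ?B = "\<lambda>z w. of_bool (z = i mod d \<and> w = j mod d) :: complex"
  have cV: "V \<in> carrier_mat (d\<^sup>2 - 1) (d\<^sup>2 - 1)" using V by (simp add: adjoint_rep_def)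
  have gm: "gm_comb d ((t \<cdot>\<^sub>m V) *\<^sub>v unit_vec (d\<^sup>2 - 1) l) $$ (i div d, j div d) =
      t * (\<Sum>x<d. \<Sum>y<d. ?A x y * gell_mann d (Suc l) $$ (x, y))" if "l < d\<^sup>2 - 1" for l
  proof -
    have "gm_comb d ((t \<cdot>\<^sub>m V) *\<^sub>v unit_vec (d\<^sup>2 - 1) l) =
        complex_of_real t \<cdot>\<^sub>m (U * gell_mann d (Suc l) * mat_adjoint U)"
      using V cV that by (simp add: smult_mat_mult_vec[OF cV] gm_comb_smult adjoint_rep_def gm_comb_unit_vec del: One_nat_def)
    then show ?thesis
      using lt U by (simp add: conjugation_index[of U d] del: index_mult_mat(1))
  qed
  have gB: "gell_mann d (Suc l) $$ (i mod d, j mod d) = (\<Sum>z<d. \<Sum>w<d. ?B z w * gell_mann d (Suc l) $$ (z, w))" for l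
    using sum_of_bool_pair[OF lt(3,4), of "\<lambda>z w. gell_mann d (Suc l) $$ (z, w)"] by (simp add: mult.commute)
  have "(\<Sum>l<d\<^sup>2 - 1. gm_comb d ((t \<cdot>\<^sub>m V) *\<^sub>v unit_vec (d\<^sup>2 - 1) l) $$ (i div d, j div d) *
      gell_mann d (Suc l) $$ (i mod d, j mod d)) =
      t * (\<Sum>l<d\<^sup>2 - 1. (\<Sum>x<d. \<Sum>y<d. ?A x y * gell_mann d (Suc l) $$ (x, y)) *
        (\<Sum>z<d. \<Sum>w<d. ?B z w * gell_mann d (Suc l) $$ (z, w)))"
    unfolding sum_distrib_left[of "complex_of_real t"]
    by (rule sum.cong[OF refl]) (simp only: gm gB lessThan_iff mult.assoc)
  also have "\<dots> = t * (2 * ((\<Sum>x<d. \<Sum>y<d. ?A x y * ?B y x) - (\<Sum>x<d. ?A x x) * (\<Sum>z<d. ?B z z) / of_nat d))"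
    by (simp only: gell_mann_bilinear_sum[OF d])
  also have "(\<Sum>x<d. \<Sum>y<d. ?A x y * ?B y x) = (\<Sum>x<d. \<Sum>y<d. ?A x y * of_bool (x = j mod d \<and> y = i mod d))"
    by (simp only: conj_commute)
  also have "\<dots> = ?A (j mod d) (i mod d)" by (rule sum_of_bool_pair[OF lt(4,3)])
  also have "(\<Sum>x<d. ?A x x) = of_bool (i div d = j div d)" by (rule unitary_rows[OF U lt(1,2)])
  also have "(\<Sum>z<d. ?B z z) = (\<Sum>z<d. if z = i mod d then of_bool (i mod d = j mod d) else 0)"
    by (rule sum.cong) auto
  also have "\<dots> = of_bool (i mod d = j mod d)" using lt by simp
  also have "of_bool (i div d = j div d) * of_bool (i mod d = j mod d) = (of_bool (i = j) :: complex)"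
    using div_mod_eq_iff[of i j d] by simp
  finally have sum: "(\<Sum>l<d\<^sup>2 - 1. gm_comb d ((t \<cdot>\<^sub>m V) *\<^sub>v unit_vec (d\<^sup>2 - 1) l) $$ (i div d, j div d) *
      gell_mann d (Suc l) $$ (i mod d, j mod d)) =
      t * (2 * (?A (j mod d) (i mod d) - of_bool (i = j) / of_nat d))" .
  show "?L $$ (i, j) = ?R $$ (i, j)"
    unfolding lmm_operator_index[OF ij] sum
    using ij d by (simp add: flip_op_def field_simps power2_eq_square)
qed auto

lemma gm_comb_mult_unit_vec:
  assumes "M \<in> carrier_mat (d\<^sup>2 - 1) (d\<^sup>2 - 1)" "l < d\<^sup>2 - 1" "x < d" "y < d"
  shows "gm_comb d (M *\<^sub>v unit_vec (d\<^sup>2 - 1) l) $$ (x, y) =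
    (\<Sum>m<d\<^sup>2 - 1. complex_of_real (M $$ (m, l)) * gell_mann d (Suc m) $$ (x, y))"
  unfolding gm_comb_index[OF assms(3,4)] using assms
  by (intro sum.cong refl) (simp add: mult_mat_unit_vec[of _ "d\<^sup>2 - 1" "d\<^sup>2 - 1"])

text \<open>Moves a matrix across the tensor product: summing \<open>A B^T e_l\<close> tensor
  \<open>e_l\<close> over \<open>l\<close> is the same as summing \<open>A e_k\<close> tensor
  \<open>B e_k\<close> over \<open>k\<close>. It turns the transposed right factor of the
  correlation matrix into a conjugation of the second subsystem.\<close>

lemma gm_comb_transfer:
  assumes A: "A \<in> carrier_mat (d\<^sup>2 - 1) (d\<^sup>2 - 1)" and B: "B \<in> carrier_mat (d\<^sup>2 - 1) (d\<^sup>2 - 1)"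
    and lt: "a < d" "c < d" "b < d" "e < d"
  shows "(\<Sum>l<d\<^sup>2 - 1. gm_comb d (A * transpose_mat B *\<^sub>v unit_vec (d\<^sup>2 - 1) l) $$ (a, c) * gell_mann d (Suc l) $$ (b, e)) =
    (\<Sum>k<d\<^sup>2 - 1. gm_comb d (A *\<^sub>v unit_vec (d\<^sup>2 - 1) k) $$ (a, c) * gm_comb d (B *\<^sub>v unit_vec (d\<^sup>2 - 1) k) $$ (b, e))"
proof -
  define N where "N = d\<^sup>2 - 1"
  note cA = A[folded N_def] and cB = B[folded N_def]
  let ?g = "\<lambda>m x y. gell_mann d (Suc m) $$ (x, y)"
  have M: "A * transpose_mat B \<in> carrier_mat (d\<^sup>2 - 1) (d\<^sup>2 - 1)" using A B by simp
  have ent: "(A * transpose_mat B) $$ (m, l) = (\<Sum>k<N. A $$ (m, k) * B $$ (l, k))" if "m < N" "l < N" for m l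
    using cA cB that by (simp add: scalar_prod_def atLeast0LessThan)
  have "(\<Sum>l<N. gm_comb d (A * transpose_mat B *\<^sub>v unit_vec N l) $$ (a, c) * ?g l b e) =
     (\<Sum>l<N. (\<Sum>m<N. (\<Sum>k<N. complex_of_real (A $$ (m, k)) * complex_of_real (B $$ (l, k))) * ?g m a c) * ?g l b e)"
    unfolding N_def by (intro sum.cong refl, subst gm_comb_mult_unit_vec[OF M])
      (use lt in \<open>auto simp: ent[unfolded N_def] simp del: index_mult_mat(1) intro!: sum.cong\<close>)
  also have "\<dots> = (\<Sum>l<N. \<Sum>m<N. \<Sum>k<N. complex_of_real (A $$ (m, k)) * ?g m a c * (complex_of_real (B $$ (l, k)) * ?g l b e))"
    unfolding sum_distrib_right by (simp only: mult_ac)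
  also have "\<dots> = (\<Sum>l<N. \<Sum>k<N. \<Sum>m<N. complex_of_real (A $$ (m, k)) * ?g m a c * (complex_of_real (B $$ (l, k)) * ?g l b e))"
    by (rule sum.cong[OF refl], rule sum.swap)
  also have "\<dots> = (\<Sum>k<N. \<Sum>l<N. \<Sum>m<N. complex_of_real (A $$ (m, k)) * ?g m a c * (complex_of_real (B $$ (l, k)) * ?g l b e))"
    by (rule sum.swap)
  also have "\<dots> = (\<Sum>k<N. \<Sum>m<N. \<Sum>l<N. complex_of_real (A $$ (m, k)) * ?g m a c * (complex_of_real (B $$ (l, k)) * ?g l b e))"
    by (rule sum.cong[OF refl], rule sum.swap)
  also have "\<dots> = (\<Sum>k<N. (\<Sum>m<N. complex_of_real (A $$ (m, k)) * ?g m a c) * (\<Sum>l<N. complex_of_real (B $$ (l, k)) * ?g l b e))"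
    by (simp only: sum_product)
  also have "\<dots> = (\<Sum>k<N. gm_comb d (A *\<^sub>v unit_vec N k) $$ (a, c) * gm_comb d (B *\<^sub>v unit_vec N k) $$ (b, e))"
    unfolding N_def using lt
    by (intro sum.cong refl) (simp add: gm_comb_mult_unit_vec[OF A] gm_comb_mult_unit_vec[OF B] del: One_nat_def)
  finally show ?thesis unfolding N_def .
qed

lemma I0_unit_vec:
  assumes "l < d\<^sup>2 - 1"
  shows "I0 d *\<^sub>v unit_vec (d\<^sup>2 - 1) l = (I0 d $$ (l, l)) \<cdot>\<^sub>v unit_vec (d\<^sup>2 - 1) l"
  using assms by (intro eq_vecI) (auto simp: I0_def mat_diag_def scalar_prod_right_unit)

text \<open>After the transfer of \<open>V'\<close>, the summands are a transposed generator
  conjugated by \<open>U\<close> tensor the generator conjugated by \<open>U'\<close>. Transposing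
  one factor turns the flip into a rank one operator, and the two unitaries merge into the
  coefficient matrix \<open>U * transpose_mat U'\<close>.\<close>

lemma lmm_operator_ent:
  assumes d: "0 < d"
    and U: "U \<in> carrier_mat d d" "U * mat_adjoint U = 1\<^sub>m d" and V: "adjoint_rep d U V"
    and U': "U' \<in> carrier_mat d d" "U' * mat_adjoint U' = 1\<^sub>m d" and V': "adjoint_rep d U' V'"
  shows "lmm_operator d (t \<cdot>\<^sub>m (V * I0 d * transpose_mat V')) =
    complex_of_real ((1 - 2 * t / real d) / (real d)\<^sup>2) \<cdot>\<^sub>m 1\<^sub>m (d * d) +
    complex_of_real (2 * t / (real d)\<^sup>2) \<cdot>\<^sub>m ent_op d (U * transpose_mat U')"
    (is "?L = ?R")
proof (rule eq_matI)
  fix i j assume "i < dim_row ?R" "j < dim_col ?R"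
  then have ij: "i < d * d" "j < d * d" by auto
  have lt: "i div d < d" "j div d < d" "i mod d < d" "j mod d < d"
    using ij d by (auto simp: less_mult_imp_div_less)
  define N where "N = d\<^sup>2 - 1"
  \<comment> \<open>Compared with the flip case \<open>x\<close> and \<open>y\<close> are exchanged:
    this is the transposition effected by \<open>I0\<close>.\<close>
  let ?A = "\<lambda>x y. U $$ (i div d, y) * cnj (U $$ (j div d, x))"
  let ?B = "\<lambda>z w. U' $$ (i mod d, z) * cnj (U' $$ (j mod d, w))"
  have cV: "V \<in> carrier_mat N N" "V' \<in> carrier_mat N N"
    using V V' by (simp_all add: adjoint_rep_def N_def)
  have cI: "I0 d \<in> carrier_mat N N" by (simp add: I0_def N_def)
  have cVI: "V * I0 d \<in> carrier_mat N N" and cM: "V * I0 d * transpose_mat V' \<in> carrier_mat N N"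
    using cV cI by auto
  have gmA: "gm_comb d (V * I0 d *\<^sub>v unit_vec N l) $$ (i div d, j div d) =
      (\<Sum>x<d. \<Sum>y<d. ?A x y * gell_mann d (Suc l) $$ (x, y))" if "l < N" for l
  proof -
    have "V * I0 d *\<^sub>v unit_vec N l = V *\<^sub>v (I0 d *\<^sub>v unit_vec N l)"
      by (rule assoc_mult_mat_vec[OF cV(1) cI]) simp
    then have "gm_comb d (V * I0 d *\<^sub>v unit_vec N l) = U * gm_comb d (I0 d *\<^sub>v unit_vec N l) * mat_adjoint U"
      using V cI by (simp add: adjoint_rep_def N_def)
    then have "gm_comb d (V * I0 d *\<^sub>v unit_vec N l) $$ (i div d, j div d) =
        (\<Sum>x<d. \<Sum>y<d. U $$ (i div d, x) * cnj (U $$ (j div d, y)) * gm_comb d (I0 d *\<^sub>v unit_vec N l) $$ (x, y))"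
      using conjugation_index[OF U(1) gm_comb_carrier lt(1,2)] by simp
    also have "\<dots> = (\<Sum>x<d. \<Sum>y<d. U $$ (i div d, x) * cnj (U $$ (j div d, y)) * gell_mann d (Suc l) $$ (y, x))"
    proof (intro sum.cong refl)
      fix x y assume xy: "x \<in> {..<d}" "y \<in> {..<d}"
      have "gm_comb d (I0 d *\<^sub>v unit_vec N l) = complex_of_real (I0 d $$ (l, l)) \<cdot>\<^sub>m gell_mann d (Suc l)"
        using that by (simp add: N_def I0_unit_vec gm_comb_smult gm_comb_unit_vec del: One_nat_def)
      then have "gm_comb d (I0 d *\<^sub>v unit_vec N l) $$ (x, y) = gell_mann d (Suc l) $$ (y, x)"
        using gell_mann_transpose[of l d x y] that xy by (simp add: N_def)
      then show "U $$ (i div d, x) * cnj (U $$ (j div d, y)) * gm_comb d (I0 d *\<^sub>v unit_vec N l) $$ (x, y) =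
          U $$ (i div d, x) * cnj (U $$ (j div d, y)) * gell_mann d (Suc l) $$ (y, x)" by simp
    qed
    also have "\<dots> = (\<Sum>x<d. \<Sum>y<d. ?A x y * gell_mann d (Suc l) $$ (x, y))"
      by (rule sum.swap)
    finally show ?thesis .
  qed
  have gmB: "gm_comb d (V' *\<^sub>v unit_vec N l) $$ (i mod d, j mod d) =
      (\<Sum>x<d. \<Sum>y<d. ?B x y * gell_mann d (Suc l) $$ (x, y))" if "l < N" for l
  proof -
    have "gm_comb d (V' *\<^sub>v unit_vec N l) = U' * gell_mann d (Suc l) * mat_adjoint U'"
      using V' that by (simp add: adjoint_rep_def N_def gm_comb_unit_vec del: One_nat_def)
    then show ?thesis using conjugation_index[OF U'(1) gell_mann_carrier lt(3,4)] by simp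
  qed
  have "(\<Sum>l<N. gm_comb d (t \<cdot>\<^sub>m (V * I0 d * transpose_mat V') *\<^sub>v unit_vec N l) $$ (i div d, j div d) *
      gell_mann d (Suc l) $$ (i mod d, j mod d)) =
      t * (\<Sum>l<N. gm_comb d (V * I0 d * transpose_mat V' *\<^sub>v unit_vec N l) $$ (i div d, j div d) *
      gell_mann d (Suc l) $$ (i mod d, j mod d))"
    unfolding sum_distrib_left
  proof (rule sum.cong[OF refl])
    fix l
    have "gm_comb d (t \<cdot>\<^sub>m (V * I0 d * transpose_mat V') *\<^sub>v unit_vec N l) =
        complex_of_real t \<cdot>\<^sub>m gm_comb d (V * I0 d * transpose_mat V' *\<^sub>v unit_vec N l)"
      using cM by (subst smult_mat_mult_vec[OF cM], simp, subst gm_comb_smult) (simp_all add: N_def)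
    then show "gm_comb d (t \<cdot>\<^sub>m (V * I0 d * transpose_mat V') *\<^sub>v unit_vec N l) $$ (i div d, j div d) *
         gell_mann d (Suc l) $$ (i mod d, j mod d) =
         complex_of_real t * (gm_comb d (V * I0 d * transpose_mat V' *\<^sub>v unit_vec N l) $$ (i div d, j div d) *
          gell_mann d (Suc l) $$ (i mod d, j mod d))"
      using lt by simp
  qed
  also have "(\<Sum>l<N. gm_comb d (V * I0 d * transpose_mat V' *\<^sub>v unit_vec N l) $$ (i div d, j div d) *
      gell_mann d (Suc l) $$ (i mod d, j mod d)) =
      (\<Sum>l<N. gm_comb d (V * I0 d *\<^sub>v unit_vec N l) $$ (i div d, j div d) * gm_comb d (V' *\<^sub>v unit_vec N l) $$ (i mod d, j mod d))"
    using gm_comb_transfer[OF cVI[unfolded N_def] cV(2)[unfolded N_def] lt] by (simp only: N_def)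
  also have "\<dots> = (\<Sum>l<N. (\<Sum>x<d. \<Sum>y<d. ?A x y * gell_mann d (Suc l) $$ (x, y)) *
        (\<Sum>z<d. \<Sum>w<d. ?B z w * gell_mann d (Suc l) $$ (z, w)))"
    by (rule sum.cong[OF refl]) (simp only: gmA gmB lessThan_iff)
  also have "\<dots> = 2 * ((\<Sum>x<d. \<Sum>y<d. ?A x y * ?B y x) - (\<Sum>x<d. ?A x x) * (\<Sum>z<d. ?B z z) / of_nat d)"
    by (simp only: N_def gell_mann_bilinear_sum[OF d])
  also have "(\<Sum>x<d. ?A x x) = of_bool (i div d = j div d)" by (rule unitary_rows[OF U lt(1,2)])
  also have "(\<Sum>z<d. ?B z z) = of_bool (i mod d = j mod d)" by (rule unitary_rows[OF U' lt(3,4)])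
  also have "of_bool (i div d = j div d) * of_bool (i mod d = j mod d) = (of_bool (i = j) :: complex)"
    using div_mod_eq_iff[of i j d] by simp
  \<comment> \<open>Owing to that exchange the row index \<open>i\<close> occurs only with
    \<open>y\<close> and the column index \<open>j\<close> only with \<open>x\<close>, so the double
    sum factorises; this is the rank one structure.\<close>
  also have "(\<Sum>x<d. \<Sum>y<d. ?A x y * ?B y x) =
      (\<Sum>y<d. U $$ (i div d, y) * U' $$ (i mod d, y)) * (\<Sum>x<d. cnj (U $$ (j div d, x)) * cnj (U' $$ (j mod d, x)))"
    unfolding sum_product by (subst sum.swap) (simp only: mult_ac)
  also have "\<dots> = ent_op d (U * transpose_mat U') $$ (i, j)"
    using ij lt U(1) U'(1) by (simp add: ent_op_def scalar_prod_def atLeast0LessThan)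
  finally have sum: "(\<Sum>l<d\<^sup>2 - 1. gm_comb d (t \<cdot>\<^sub>m (V * I0 d * transpose_mat V') *\<^sub>v unit_vec (d\<^sup>2 - 1) l) $$ (i div d, j div d) *
      gell_mann d (Suc l) $$ (i mod d, j mod d)) =
      t * (2 * (ent_op d (U * transpose_mat U') $$ (i, j) - of_bool (i = j) / of_nat d))"
    unfolding N_def .
  show "?L $$ (i, j) = ?R $$ (i, j)"
    unfolding lmm_operator_index[OF ij] sum
    using ij d by (simp add: field_simps power2_eq_square)
qed auto

section \<open>Algebra of the flip and of the entangled projection\<close>

lemma kron_index:
  assumes "A \<in> carrier_mat d d" "B \<in> carrier_mat d d" "i < d * d" "j < d * d"
  shows "kron A B $$ (i, j) = A $$ (i div d, j div d) * B $$ (i mod d, j mod d)"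
  using assms by (simp add: kron_def)

lemma mat_adjoint_kron:
  assumes A: "A \<in> carrier_mat d d" and B: "B \<in> carrier_mat d d"
  shows "mat_adjoint (kron A B) = kron (mat_adjoint A) (mat_adjoint B)"
proof (rule eq_matI)
  fix i j assume "i < dim_row (kron (mat_adjoint A) (mat_adjoint B))" "j < dim_col (kron (mat_adjoint A) (mat_adjoint B))"
  then have ij: "i < d * d" "j < d * d" using A B by auto
  then have "0 < d" by (cases d) auto
  then have "i div d < d" "j div d < d" "i mod d < d" "j mod d < d"
    using ij by (auto simp: less_mult_imp_div_less)
  then show "mat_adjoint (kron A B) $$ (i, j) = kron (mat_adjoint A) (mat_adjoint B) $$ (i, j)"
    using ij A B by (simp add: kron_index[where d = d])
qed (use A B in auto)

lemma kron_zero_left [simp]: "kron (0\<^sub>m d d) (B :: complex mat) = 0\<^sub>m (d * dim_row B) (d * dim_col B)"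
  by (rule eq_matI) (auto simp: kron_def less_mult_imp_div_less)

lemma matrix_trace_kron:
  assumes d: "0 < d" and A: "A \<in> carrier_mat d d" and B: "B \<in> carrier_mat d d"
  shows "matrix_trace (kron A B) = matrix_trace A * matrix_trace B"
proof -
  have "matrix_trace (kron A B) = (\<Sum>l<d * d. A $$ (l div d, l div d) * B $$ (l mod d, l mod d))"
    using A B by (simp add: matrix_trace_def kron_index[where d = d])
  also have "\<dots> = (\<Sum>a<d. \<Sum>b<d. A $$ (a, a) * B $$ (b, b))"
    by (rule sum_div_mod[OF d])
  finally show ?thesis using A B by (simp add: matrix_trace_def sum_product)
qed

lemma unitary_cols:
  fixes U :: "complex mat"
  assumes U: "U \<in> carrier_mat d d" "U * mat_adjoint U = 1\<^sub>m d" and lt: "a < d" "c < d"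
  shows "(\<Sum>x<d. cnj (U $$ (x, a)) * U $$ (x, c)) = of_bool (a = c)"
proof -
  have "mat_adjoint U * U = 1\<^sub>m d"
    by (rule mat_mult_left_right_inverse[OF U(1) _ U(2)]) (use U in simp)
  moreover have "(mat_adjoint U * U) $$ (a, c) = (\<Sum>x<d. cnj (U $$ (x, a)) * U $$ (x, c))"
    using U(1) lt by (simp add: scalar_prod_def atLeast0LessThan)
  ultimately show ?thesis using lt by (cases "a = c") auto
qed

lemma ent_op_index:
  "i < d * d \<Longrightarrow> j < d * d \<Longrightarrow>
    ent_op d G $$ (i, j) = G $$ (i div d, i mod d) * cnj (G $$ (j div d, j mod d))"
  by (simp add: ent_op_def)

lemma mult_mat_index_pairs:
  assumes d: "0 < d" and A: "A \<in> carrier_mat (d * d) (d * d)" and B: "B \<in> carrier_mat (d * d) (d * d)"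
    and ij: "i < d * d" "j < d * d"
    and f: "\<And>l. l < d * d \<Longrightarrow> A $$ (i, l) * B $$ (l, j) = f (l div d) (l mod d)"
  shows "(A * B) $$ (i, j) = (\<Sum>a<d. \<Sum>b<d. f a b)"
proof -
  have "(A * B) $$ (i, j) = (\<Sum>l<d * d. f (l div d) (l mod d))"
    using A B ij f by (simp add: scalar_prod_def atLeast0LessThan)
  then show ?thesis using sum_div_mod[OF d, of f] by simp
qed

section \<open>Both operators for a unitary coefficient matrix: squares, traces, passage of local
  operators\<close>

context
  fixes d :: nat and U :: "complex mat"
  assumes d: "0 < d" and U: "U \<in> carrier_mat d d" "U * mat_adjoint U = 1\<^sub>m d"
begin

private lemma pair_bounds:
  "i < d * d \<Longrightarrow> i div d < d" "i mod d < d"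
  using d by (auto simp: less_mult_imp_div_less)

lemma flip_op_hermitian: "mat_adjoint (flip_op d U) = flip_op d U"
  by (rule eq_matI) (auto simp: flip_op_def)

lemma ent_op_hermitian: "mat_adjoint (ent_op d U) = ent_op d U"
  by (rule eq_matI) (auto simp: ent_op_def)

lemma flip_op_square: "flip_op d U * flip_op d U = 1\<^sub>m (d * d)"
proof (rule eq_matI)
  fix i j assume "i < dim_row (1\<^sub>m (d * d) :: complex mat)" "j < dim_col (1\<^sub>m (d * d) :: complex mat)"
  then have ij: "i < d * d" "j < d * d" by auto
  have "(flip_op d U * flip_op d U) $$ (i, j) = (\<Sum>c<d. \<Sum>e<d.
      U $$ (i div d, e) * cnj (U $$ (c, i mod d)) * (U $$ (c, j mod d) * cnj (U $$ (j div d, e))))"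
    by (rule mult_mat_index_pairs[OF d]) (use ij in \<open>auto simp: flip_op_def\<close>)
  also have "\<dots> = (\<Sum>c<d. cnj (U $$ (c, i mod d)) * U $$ (c, j mod d)) *
      (\<Sum>e<d. U $$ (i div d, e) * cnj (U $$ (j div d, e)))"
    unfolding sum_product by (simp only: mult_ac)
  also have "\<dots> = of_bool (i mod d = j mod d) * of_bool (i div d = j div d)"
    using unitary_cols[OF U, of "i mod d" "j mod d"] unitary_rows[OF U, of "i div d" "j div d"] ij pair_bounds
    by simp
  also have "\<dots> = (1\<^sub>m (d * d) :: complex mat) $$ (i, j)"
    using ij div_mod_eq_iff[of i j d] by auto
  finally show "(flip_op d U * flip_op d U) $$ (i, j) = (1\<^sub>m (d * d) :: complex mat) $$ (i, j)" .
qed auto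

lemma unitary_entries_sum: "(\<Sum>a<d. \<Sum>b<d. U $$ (a, b) * cnj (U $$ (a, b))) = of_nat d"
proof -
  have "(\<Sum>a<d. \<Sum>b<d. U $$ (a, b) * cnj (U $$ (a, b))) = (\<Sum>a<d. 1)"
    by (rule sum.cong[OF refl]) (simp add: unitary_rows[OF U])
  then show ?thesis by simp
qed

text \<open>For the vector \<open>\<psi>\<close> of entries of \<open>U\<close>, the factor is its
  squared norm, which is \<open>d\<close> because each of the \<open>d\<close> rows has norm
  one.\<close>

lemma ent_op_square: "ent_op d U * ent_op d U = of_nat d \<cdot>\<^sub>m ent_op d U"
proof (rule eq_matI)
  fix i j assume "i < dim_row (of_nat d \<cdot>\<^sub>m ent_op d U)" "j < dim_col (of_nat d \<cdot>\<^sub>m ent_op d U)"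
  then have ij: "i < d * d" "j < d * d" by auto
  have "(ent_op d U * ent_op d U) $$ (i, j) = (\<Sum>c<d. \<Sum>e<d.
      U $$ (i div d, i mod d) * cnj (U $$ (c, e)) * (U $$ (c, e) * cnj (U $$ (j div d, j mod d))))"
    by (rule mult_mat_index_pairs[OF d]) (use ij in \<open>auto simp: ent_op_def\<close>)
  also have "\<dots> = (\<Sum>c<d. \<Sum>e<d. U $$ (c, e) * cnj (U $$ (c, e))) *
      (U $$ (i div d, i mod d) * cnj (U $$ (j div d, j mod d)))"
    unfolding sum_distrib_right by (simp only: mult_ac)
  finally show "(ent_op d U * ent_op d U) $$ (i, j) = (of_nat d \<cdot>\<^sub>m ent_op d U) $$ (i, j)"
    using ij unfolding unitary_entries_sum by (simp add: ent_op_def)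
qed auto

lemma matrix_trace_flip_op: "matrix_trace (flip_op d U) = of_nat d"
proof -
  have "matrix_trace (flip_op d U) = (\<Sum>l<d * d. U $$ (l div d, l mod d) * cnj (U $$ (l div d, l mod d)))"
    by (simp add: matrix_trace_def flip_op_def)
  also have "\<dots> = (\<Sum>a<d. \<Sum>b<d. U $$ (a, b) * cnj (U $$ (a, b)))"
    by (rule sum_div_mod[OF d])
  finally show ?thesis by (simp only: unitary_entries_sum)
qed

lemma matrix_trace_ent_op: "matrix_trace (ent_op d U) = of_nat d"
proof -
  have "matrix_trace (ent_op d U) = (\<Sum>l<d * d. U $$ (l div d, l mod d) * cnj (U $$ (l div d, l mod d)))"
    by (simp add: matrix_trace_def ent_op_def)
  also have "\<dots> = (\<Sum>a<d. \<Sum>b<d. U $$ (a, b) * cnj (U $$ (a, b)))"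
    by (rule sum_div_mod[OF d])
  finally show ?thesis by (simp only: unitary_entries_sum)
qed

text \<open>The flip exchanges the tensor factors; being conjugated by \<open>U\<close> on the first
  one, it carries \<open>A\<close> to the second factor as \<open>A\<close> conjugated by the
  adjoint of \<open>U\<close>.\<close>

lemma flip_op_kron_swap:
  assumes A: "A \<in> carrier_mat d d"
  shows "flip_op d U * kron A (1\<^sub>m d) = kron (1\<^sub>m d) (mat_adjoint U * A * U) * flip_op d U"
proof (rule eq_matI)
  let ?A = "mat_adjoint U * A * U"
  have cA: "?A \<in> carrier_mat d d" using A U by auto
  fix i j assume "i < dim_row (kron (1\<^sub>m d) ?A * flip_op d U)" "j < dim_col (kron (1\<^sub>m d) ?A * flip_op d U)"
  then have ij: "i < d * d" "j < d * d" using U by auto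
  note b = pair_bounds(1)[OF ij(1)] pair_bounds(1)[OF ij(2)] pair_bounds(2)
  have adj: "(M * mat_adjoint U) $$ (x, y) = (\<Sum>b<d. M $$ (x, b) * cnj (U $$ (y, b)))"
    if "M \<in> carrier_mat d d" "x < d" "y < d" for M x y
    using that U(1) by (simp add: scalar_prod_def atLeast0LessThan)
  have "(flip_op d U * kron A (1\<^sub>m d)) $$ (i, j) = (\<Sum>c<d. \<Sum>e<d.
      U $$ (i div d, e) * cnj (U $$ (c, i mod d)) * (A $$ (c, j div d) * (if e = j mod d then 1 else 0)))"
    by (rule mult_mat_index_pairs[OF d])
      (use ij A b in \<open>auto simp: flip_op_def kron_index[where d = d]\<close>)
  also have "\<dots> = (\<Sum>c<d. \<Sum>e<d. if e = j mod d then U $$ (i div d, e) * cnj (U $$ (c, i mod d)) * A $$ (c, j div d) else 0)"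
    by (intro sum.cong refl) simp
  also have "\<dots> = (\<Sum>c<d. U $$ (i div d, j mod d) * (cnj (U $$ (c, i mod d)) * A $$ (c, j div d)))"
    using b by (simp add: mult.assoc)
  also have "\<dots> = U $$ (i div d, j mod d) * (mat_adjoint U * A) $$ (i mod d, j div d)"
    using A U b by (simp add: scalar_prod_def atLeast0LessThan sum_distrib_left)
  \<comment> \<open>Inserts \<open>U * mat_adjoint U = 1\<close>, so that the second column entry of
    \<open>flip_op\<close> reappears; the sum over \<open>a\<close> added below is a Kronecker delta
    for the identity factor.\<close>
  also have "mat_adjoint U * A = ?A * mat_adjoint U"
    using A U by (simp add: assoc_mult_mat[of _ d d _ d _ d])
  also have "U $$ (i div d, j mod d) * (?A * mat_adjoint U) $$ (i mod d, j div d) =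
      (\<Sum>b<d. ?A $$ (i mod d, b) * (U $$ (i div d, j mod d) * cnj (U $$ (j div d, b))))"
    using adj[OF cA b(3) b(2)] by (simp only: sum_distrib_left mult_ac)
  also have "\<dots> = (\<Sum>b<d. \<Sum>a<d. if a = i div d then ?A $$ (i mod d, b) * (U $$ (a, j mod d) * cnj (U $$ (j div d, b))) else 0)"
    using b by simp
  also have "\<dots> = (\<Sum>a<d. \<Sum>b<d. if a = i div d then ?A $$ (i mod d, b) * (U $$ (a, j mod d) * cnj (U $$ (j div d, b))) else 0)"
    by (rule sum.swap)
  also have "\<dots> = (\<Sum>a<d. \<Sum>b<d. (if i div d = a then 1 else 0) * ?A $$ (i mod d, b) * (U $$ (a, j mod d) * cnj (U $$ (j div d, b))))"
    by (intro sum.cong refl) auto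
  also have "\<dots> = (kron (1\<^sub>m d) ?A * flip_op d U) $$ (i, j)"
    by (rule mult_mat_index_pairs[OF d, symmetric])
      (use ij cA b pair_bounds(1) in \<open>auto simp: flip_op_def kron_index[where d = d] simp del: index_mult_mat(1)\<close>)
  finally show "(flip_op d U * kron A (1\<^sub>m d)) $$ (i, j) = (kron (1\<^sub>m d) ?A * flip_op d U) $$ (i, j)" .
qed (use A U in auto)

text \<open>A rank one operator \<open>\<psi> \<psi>^*\<close> compresses any operator to the scalar
  given by its form at \<open>\<psi>\<close>. For unitary \<open>U\<close> the reduction of
  \<open>\<psi> \<psi>^*\<close> to the first factor is the identity, so this scalar is
  \<open>tr A\<close>; it is 1 for a measurement projector.\<close>

lemma ent_op_kron_sandwich:
  assumes A: "A \<in> carrier_mat d d"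
  shows "ent_op d U * kron A (1\<^sub>m d) * ent_op d U = matrix_trace A \<cdot>\<^sub>m ent_op d U"
proof (rule eq_matI)
  fix i j assume "i < dim_row (matrix_trace A \<cdot>\<^sub>m ent_op d U)" "j < dim_col (matrix_trace A \<cdot>\<^sub>m ent_op d U)"
  then have ij: "i < d * d" "j < d * d" by auto
  note b = pair_bounds(1)[OF ij(1)] pair_bounds(1)[OF ij(2)] pair_bounds(2)
  let ?u = "U $$ (i div d, i mod d)" and ?v = "cnj (U $$ (j div d, j mod d))"
  have left: "(ent_op d U * kron A (1\<^sub>m d)) $$ (i, l) = (\<Sum>c<d. ?u * cnj (U $$ (c, l mod d)) * A $$ (c, l div d))"
    if l: "l < d * d" for l
  proof -
    have "(ent_op d U * kron A (1\<^sub>m d)) $$ (i, l) = (\<Sum>c<d. \<Sum>e<d.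
        ?u * cnj (U $$ (c, e)) * (A $$ (c, l div d) * (if e = l mod d then 1 else 0)))"
      by (rule mult_mat_index_pairs[OF d])
        (use ij A b l in \<open>auto simp: ent_op_def kron_index[where d = d]\<close>)
    also have "\<dots> = (\<Sum>c<d. \<Sum>e<d. if e = l mod d then ?u * cnj (U $$ (c, e)) * A $$ (c, l div d) else 0)"
      by (intro sum.cong refl) simp
    finally show ?thesis using pair_bounds(2) by simp
  qed
  have "(ent_op d U * kron A (1\<^sub>m d) * ent_op d U) $$ (i, j) =
      (\<Sum>a<d. \<Sum>e<d. (\<Sum>c<d. ?u * cnj (U $$ (c, e)) * A $$ (c, a)) * (U $$ (a, e) * ?v))"
    by (rule mult_mat_index_pairs[OF d])
      (use ij A b in \<open>auto simp: left ent_op_index simp del: index_mult_mat(1)\<close>)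
  also have "\<dots> = (\<Sum>a<d. \<Sum>e<d. \<Sum>c<d. ?u * ?v * A $$ (c, a) * (U $$ (a, e) * cnj (U $$ (c, e))))"
    unfolding sum_distrib_right by (simp only: mult_ac)
  also have "\<dots> = (\<Sum>a<d. \<Sum>c<d. \<Sum>e<d. ?u * ?v * A $$ (c, a) * (U $$ (a, e) * cnj (U $$ (c, e))))"
    by (rule sum.cong[OF refl], rule sum.swap)
  also have "\<dots> = (\<Sum>a<d. \<Sum>c<d. if c = a then ?u * ?v * A $$ (c, a) else 0)"
    by (intro sum.cong refl, unfold sum_distrib_left[symmetric], subst unitary_rows[OF U]) auto
  also have "\<dots> = (\<Sum>a<d. ?u * ?v * A $$ (a, a))" by simp
  also have "\<dots> = (matrix_trace A \<cdot>\<^sub>m ent_op d U) $$ (i, j)"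
    using ij A unfolding sum_distrib_left[symmetric] by (simp add: ent_op_def matrix_trace_def)
  finally show "(ent_op d U * kron A (1\<^sub>m d) * ent_op d U) $$ (i, j) = (matrix_trace A \<cdot>\<^sub>m ent_op d U) $$ (i, j)" .
qed (use A in auto)

end

lemma mult_conjugation:
  fixes W A B :: "complex mat"
  assumes W: "W \<in> carrier_mat d d" "mat_adjoint W * W = 1\<^sub>m d"
    and A: "A \<in> carrier_mat d d" and B: "B \<in> carrier_mat d d"
  shows "W * A * mat_adjoint W * (W * B * mat_adjoint W) = W * (A * B) * mat_adjoint W"
proof -
  have "mat_adjoint W * (W * C) = C" if "C \<in> carrier_mat d d" for C
    using assoc_mult_mat[of "mat_adjoint W" d d W d C d] W that by simp
  then show ?thesis
    using W(1) A B by (simp add: assoc_mult_mat[of _ d d _ d _ d])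
qed

section \<open>Measurements\<close>

text \<open>A maximal independent set of columns has \<open>rank\<close> many elements, hence
  consists of a single column \<open>s\<close>, and every other column is a multiple of it.
  \<open>u\<close> lists the coordinates of \<open>s\<close>, \<open>w\<close> the
  multiples.\<close>

lemma rank_one_product:
  fixes P :: "complex mat"
  assumes P: "P \<in> carrier_mat d d" and r: "vec_space.rank d P = 1"
  obtains u w where "\<And>i j. i < d \<Longrightarrow> j < d \<Longrightarrow> P $$ (i, j) = u i * w j"
proof -
  interpret V: vec_space "TYPE(complex)" d .
  have sub: "set (cols P) \<subseteq> carrier_vec d" using P cols_dim by blast
  have "V.lin_indpt {}"
    unfolding V.lin_dep_def by blast
  then obtain S where S: "maximal S (\<lambda>T. T \<subseteq> set (cols P) \<and> V.lin_indpt T)"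
    using maximal_exists_superset[of "set (cols P)" "\<lambda>T. T \<subseteq> set (cols P) \<and> V.lin_indpt T" "{}"] by blast
  then have "card S = 1" using V.rank_card_indpt[OF P S] r by simp
  then obtain s where s: "S = {s}" by (auto simp: card_1_singleton_iff)
  have sS: "s \<in> set (cols P)" "V.lin_indpt {s}" using S s by (auto simp: maximal_def)
  have sc: "s \<in> carrier_vec d" using sS sub by blast
  have "\<exists>a. c = a \<cdot>\<^sub>v s" if c: "c \<in> set (cols P)" for c
  proof (cases "c = s")
    case True
    then show ?thesis by (intro exI[of _ 1]) simp
  next
    case False
    have cc: "c \<in> carrier_vec d" using c sub by blast
    have "V.lin_dep ({s} \<union> {c})"
    proof (rule ccontr)
      assume "\<not> V.lin_dep ({s} \<union> {c})"
      moreover have "{s} \<union> {c} \<subseteq> set (cols P)" using c sS by simp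
      ultimately have "S = {s} \<union> {c}" using S[unfolded maximal_def] unfolding s by (metis (no_types, lifting) Un_upper1)
      then show False using s False by auto
    qed
    then have "c \<in> V.span {s}"
      using V.lin_dep_iff_in_span[of "{s}" c] sc cc sS(2) False by auto
    then obtain a where "c = V.lincomb a {s}"
      using V.finite_in_span[of "{s}" c] sc by auto
    then show ?thesis using sc by (intro exI[of _ "a s"]) (simp add: V.lincomb_def)
  qed
  then have "\<forall>j<d. \<exists>a. col P j = a \<cdot>\<^sub>v s" using P by (auto simp: cols_def)
  then obtain w where w: "\<And>j. j < d \<Longrightarrow> col P j = w j \<cdot>\<^sub>v s" by metis
  have "P $$ (i, j) = s $ i * w j" if "i < d" "j < d" for i j
  proof -
    have "P $$ (i, j) = col P j $ i" using P that by simp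
    then show ?thesis using w[OF that(2)] sc that by simp
  qed
  then show thesis using that[of "\<lambda>i. s $ i" w] by blast
qed

text \<open>For entries \<open>u i * w j\<close> the square of \<open>P\<close> is
  \<open>tr P\<close> times \<open>P\<close>; an idempotent with a nonzero entry then has trace
  one.\<close>

lemma idempotent_rank_one_trace:
  fixes P :: "complex mat"
  assumes P: "P \<in> carrier_mat d d" and id: "P * P = P" and r: "vec_space.rank d P = 1"
  shows "matrix_trace P = 1"
proof -
  obtain u w where uw: "\<And>i j. i < d \<Longrightarrow> j < d \<Longrightarrow> P $$ (i, j) = u i * w j"
    using rank_one_product[OF P r] by blast
  have tr: "matrix_trace P = (\<Sum>k<d. u k * w k)" using P by (simp add: matrix_trace_def uw)
  have eq: "P $$ (i, j) = matrix_trace P * P $$ (i, j)" if "i < d" "j < d" for i j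
  proof -
    have "(P * P) $$ (i, j) = (\<Sum>k<d. u i * w k * (u k * w j))"
      using P that by (simp add: scalar_prod_def atLeast0LessThan uw)
    also have "\<dots> = matrix_trace P * (u i * w j)"
      unfolding tr sum_distrib_right by (simp only: mult_ac)
    finally show ?thesis using id uw that by simp
  qed
  have "P \<noteq> 0\<^sub>m d d" using r vec_space.rank_0I[of d d, where ?'a = complex] by auto
  then obtain i j where "i < d" "j < d" "P $$ (i, j) \<noteq> 0"
    using P by (metis carrier_matD eq_matI index_zero_mat)
  then show ?thesis using eq[of i j] by simp
qed

text \<open>The product form of the entries bounds the rank by one; column \<open>k\<close> is
  nonzero and so an independent singleton.\<close>

lemma rank_mat_unit:
  assumes k: "k < d"
  shows "vec_space.rank d (mat_unit d (Suc k) (Suc k)) = 1"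
proof -
  interpret V: vec_space "TYPE(complex)" d .
  let ?E = "mat_unit d (Suc k) (Suc k)"
  have E: "?E \<in> carrier_mat d d" by (simp add: mat_unit_def)
  have "V.rank ?E \<le> 1"
    by (rule V.rank_le_1_product_entries[OF E, of "\<lambda>r. of_bool (r = k)" "\<lambda>c. of_bool (c = k)"]) auto
  moreover have "1 \<le> V.rank ?E"
  proof (rule ccontr)
    assume "\<not> 1 \<le> V.rank ?E"
    have c: "col ?E k \<in> set (cols ?E)" using k by (auto simp: cols_def)
    have ne: "col ?E k \<noteq> 0\<^sub>v d"
    proof
      assume "col ?E k = 0\<^sub>v d"
      then have "col ?E k $ k = 0" using k by simp
      then show False using k by simp
    qed
    have "V.lin_indpt {col ?E k}"
    proof -
      have "V.lin_indpt {}"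
        unfolding V.lin_dep_def by blast
      moreover have "col ?E k \<notin> V.span {}" using ne by (simp add: V.span_empty)
      moreover have "col ?E k \<in> carrier_vec d" using col_dim[of ?E k] by simp
      ultimately show ?thesis using V.lin_dep_iff_in_span[of "{}" "col ?E k"] by auto
    qed
    then have "card {col ?E k} \<le> V.rank ?E"
      using V.rank_ge_card_indpt[OF E, of "{col ?E k}"] c by simp
    then show False using \<open>\<not> 1 \<le> V.rank ?E\<close> by simp
  qed
  ultimately show ?thesis by simp
qed

text \<open>The standard basis measurement makes the set minimised in \<open>discord\<close>
  nonempty; over an empty set \<open>LEAST\<close> would be unspecified.\<close>

lemma projective_measurement_mat_unit:
  "projective_measurement d (\<lambda>k. mat_unit d (Suc k) (Suc k))"
  unfolding projective_measurement_def
proof (intro conjI allI impI)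
  fix k assume k: "k < d"
  show "mat_unit d (Suc k) (Suc k) \<in> carrier_mat d d" by (simp add: mat_unit_def)
  show "mat_adjoint (mat_unit d (Suc k) (Suc k)) = mat_unit d (Suc k) (Suc k)"
    by (rule eq_matI) auto
  show "vec_space.rank d (mat_unit d (Suc k) (Suc k)) = 1" by (rule rank_mat_unit[OF k])
  have m: "(mat_unit d (Suc j) (Suc j) * mat_unit d (Suc k) (Suc k)) $$ (a, b) =
      (if a = j \<and> j = k \<and> b = k then 1 else 0)" if "a < d" "b < d" for a b j
  proof -
    have "(mat_unit d (Suc j) (Suc j) * mat_unit d (Suc k) (Suc k)) $$ (a, b) =
        (\<Sum>x<d. of_bool (a = j \<and> x = j) * of_bool (x = k \<and> b = k))"
      using that by (simp add: scalar_prod_def atLeast0LessThan)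
    also have "\<dots> = (\<Sum>x<d. if x = k then if a = j \<and> j = k \<and> b = k then 1 else 0 else 0)"
      by (intro sum.cong refl) auto
    finally show ?thesis using k by simp
  qed
  show "mat_unit d (Suc k) (Suc k) * mat_unit d (Suc k) (Suc k) = mat_unit d (Suc k) (Suc k)"
    by (rule eq_matI) (auto simp: m simp del: index_mult_mat(1))
  fix j assume "j < d" "j \<noteq> k"
  then show "mat_unit d (Suc j) (Suc j) * mat_unit d (Suc k) (Suc k) = 0\<^sub>m d d"
    by (intro eq_matI) (auto simp: m simp del: index_mult_mat(1))
next
  show "matrix_sum d d (\<lambda>k. mat_unit d (Suc k) (Suc k)) {..<d} = 1\<^sub>m d"
  proof (rule eq_matI)
    fix i j assume "i < dim_row (1\<^sub>m d :: complex mat)" "j < dim_col (1\<^sub>m d :: complex mat)"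
    then have ij: "i < d" "j < d" by auto
    have "(\<Sum>k<d. mat_unit d (Suc k) (Suc k) $$ (i, j)) = (\<Sum>k<d. if k = i then if i = j then 1 else 0 else 0)"
      using ij by (intro sum.cong refl) auto
    then show "matrix_sum d d (\<lambda>k. mat_unit d (Suc k) (Suc k)) {..<d} $$ (i, j) = 1\<^sub>m d $$ (i, j)"
      using ij by simp
  qed auto
qed

lemma discord_constant:
  assumes "\<And>P. projective_measurement d P \<Longrightarrow> trace_norm (\<rho> - local_measure_map d P \<rho>) = c"
  shows "discord d \<rho> = real d / (2 * (real d - 1)) * c"
proof -
  have "(LEAST x. \<exists>P. projective_measurement d P \<and> x = trace_norm (\<rho> - local_measure_map d P \<rho>)) = c"
    using assms projective_measurement_mat_unit by (intro Least_equality) fastforce+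
  then show ?thesis by (simp add: discord_def)
qed

section \<open>Disturbance of the two operators by a fixed measurement\<close>

context
  fixes d :: nat and P :: "nat \<Rightarrow> complex mat"
  assumes d: "0 < d" and P: "projective_measurement d P"
begin

private abbreviation "Q k \<equiv> kron (P k) (1\<^sub>m d)"

lemma measurementD:
  assumes "k < d"
  shows "P k \<in> carrier_mat d d" "mat_adjoint (P k) = P k" "P k * P k = P k" "matrix_trace (P k) = 1"
  using P assms idempotent_rank_one_trace[of "P k" d] by (auto simp: projective_measurement_def)

lemma measurement_orthogonal: "j < d \<Longrightarrow> k < d \<Longrightarrow> j \<noteq> k \<Longrightarrow> P j * P k = 0\<^sub>m d d"
  using P by (auto simp: projective_measurement_def)

private lemma QD:
  assumes "k < d"
  shows "Q k \<in> carrier_mat (d * d) (d * d)" "mat_adjoint (Q k) = Q k" "Q k * Q k = Q k"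
  using measurementD[OF assms] by (auto simp: mat_adjoint_kron[where d = d] kron_mult[where d = d])

private lemma Q_orth: "j < d \<Longrightarrow> k < d \<Longrightarrow> j \<noteq> k \<Longrightarrow> Q j * Q k = 0\<^sub>m (d * d) (d * d)"
  using measurementD(1) measurement_orthogonal by (simp add: kron_mult[where d = d])

private lemma Q_sum: "matrix_sum (d * d) (d * d) Q {..<d} = 1\<^sub>m (d * d)"
proof (rule eq_matI)
  fix i j assume "i < dim_row (1\<^sub>m (d * d) :: complex mat)" "j < dim_col (1\<^sub>m (d * d) :: complex mat)"
  then have ij: "i < d * d" "j < d * d" by auto
  have lt: "i div d < d" "j div d < d" "i mod d < d" "j mod d < d"
    using ij d by (auto simp: less_mult_imp_div_less)
  have "(\<Sum>k<d. Q k $$ (i, j)) = (\<Sum>k<d. P k $$ (i div d, j div d)) * 1\<^sub>m d $$ (i mod d, j mod d)"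
    unfolding sum_distrib_right using measurementD(1) ij
    by (intro sum.cong refl) (simp add: kron_index[where d = d])
  also have "(\<Sum>k<d. P k $$ (i div d, j div d)) = matrix_sum d d P {..<d} $$ (i div d, j div d)"
    using lt by simp
  also have "matrix_sum d d P {..<d} = 1\<^sub>m d" using P by (simp add: projective_measurement_def)
  finally show "matrix_sum (d * d) (d * d) Q {..<d} $$ (i, j) = (1\<^sub>m (d * d) :: complex mat) $$ (i, j)"
    using ij lt div_mod_eq_iff[of i j d] by auto
qed auto

text \<open>The \<open>Q k\<close> are idempotent and add up to the identity, so the measurement
  fixes the identity part, which then drops out of the difference.\<close>

lemma local_measure_map_affine:
  assumes X: "X \<in> carrier_mat (d * d) (d * d)"
  shows "a \<cdot>\<^sub>m 1\<^sub>m (d * d) + b \<cdot>\<^sub>m X - local_measure_map d P (a \<cdot>\<^sub>m 1\<^sub>m (d * d) + b \<cdot>\<^sub>m X) =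
    b \<cdot>\<^sub>m (X - local_measure_map d P X)"
proof (rule eq_matI)
  fix i j assume "i < dim_row (b \<cdot>\<^sub>m (X - local_measure_map d P X))" "j < dim_col (b \<cdot>\<^sub>m (X - local_measure_map d P X))"
  then have ij: "i < d * d" "j < d * d" by (auto simp: local_measure_map_def)
  let ?I = "1\<^sub>m (d * d) :: complex mat"
  have "(\<Sum>k<d. (Q k * (a \<cdot>\<^sub>m ?I + b \<cdot>\<^sub>m X) * Q k) $$ (i, j)) = (\<Sum>k<d. a * Q k $$ (i, j) + b * (Q k * X * Q k) $$ (i, j))"
  proof (rule sum.cong[OF refl])
    fix k assume "k \<in> {..<d}"
    then have k: "k < d" by simp
    have "Q k * (a \<cdot>\<^sub>m ?I + b \<cdot>\<^sub>m X) * Q k = a \<cdot>\<^sub>m (Q k * Q k) + b \<cdot>\<^sub>m (Q k * X * Q k)"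
      using QD(1)[OF k] X by (simp add: mult_add_distrib_mat[of _ "d * d" "d * d" _ "d * d"] add_mult_distrib_mat[of _ "d * d" "d * d" _ _ "d * d"]
        mult_smult_distrib[of _ "d * d" "d * d" _ "d * d"] mult_smult_assoc_mat[of _ "d * d" "d * d" _ "d * d"] right_mult_one_mat[of _ "d * d"])
    moreover have "dim_row (Q k) = d * d" "dim_col (Q k) = d * d" using QD(1)[OF k] by blast+
    ultimately show "(Q k * (a \<cdot>\<^sub>m ?I + b \<cdot>\<^sub>m X) * Q k) $$ (i, j) = a * Q k $$ (i, j) + b * (Q k * X * Q k) $$ (i, j)"
      using ij by (simp add: QD(3)[OF k] del: index_mult_mat(1) dim_kron)
  qed
  also have "\<dots> = a * (\<Sum>k<d. Q k $$ (i, j)) + b * (\<Sum>k<d. (Q k * X * Q k) $$ (i, j))"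
    by (simp only: sum.distrib sum_distrib_left)
  also have "(\<Sum>k<d. Q k $$ (i, j)) = ?I $$ (i, j)"
    using arg_cong[OF Q_sum, of "\<lambda>A. A $$ (i, j)"] ij by simp
  finally show "(a \<cdot>\<^sub>m 1\<^sub>m (d * d) + b \<cdot>\<^sub>m X - local_measure_map d P (a \<cdot>\<^sub>m 1\<^sub>m (d * d) + b \<cdot>\<^sub>m X)) $$ (i, j) =
      (b \<cdot>\<^sub>m (X - local_measure_map d P X)) $$ (i, j)"
    using ij X by (simp add: local_measure_map_def algebra_simps del: index_mult_mat(1))
qed (auto simp: local_measure_map_def)

text \<open>If \<open>X Q\<^sub>k X = X\<close> for all \<open>k\<close>, then \<open>Y = \<Sum> Q\<^sub>k X Q\<^sub>k\<close> is a projection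
  that fixes \<open>X\<close>.\<close>

lemma trace_norm_ent_op:
  assumes "2 \<le> d" and G: "G \<in> carrier_mat d d" "G * mat_adjoint G = 1\<^sub>m d"
  shows "trace_norm (complex_of_real b \<cdot>\<^sub>m (ent_op d G - local_measure_map d P (ent_op d G))) = \<bar>b\<bar> * (2 * (real d - 1))"
proof -
  define n where "n = d * d"
  define X where "X = ent_op d G"
  define Y where "Y = local_measure_map d P X"
  have X: "X \<in> carrier_mat n n" "mat_adjoint X = X" "X * X = of_nat d \<cdot>\<^sub>m X" "matrix_trace X = of_nat d"
    using ent_op_hermitian[OF d G] ent_op_square[OF d G] matrix_trace_ent_op[OF d G] by (auto simp: X_def n_def)
  note Q = QD[folded n_def]
  have one_smult: "1 \<cdot>\<^sub>m A = A" for A :: "complex mat" by (rule eq_matI) auto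
  have XQX: "X * Q k * X = X" if "k < d" for k
    using ent_op_kron_sandwich[OF d G measurementD(1)[OF that]] measurementD(4)[OF that]
    by (simp add: X_def one_smult)
  have Ydef: "Y = matrix_sum n n (\<lambda>k. Q k * X * Q k) {..<d}" by (simp add: Y_def local_measure_map_def n_def)
  have cT: "Q k * X * Q k \<in> carrier_mat n n" if "k < d" for k using Q(1)[OF that] X(1) by (metis mult_carrier_mat)
  have cY: "Y \<in> carrier_mat n n" by (simp add: Ydef)
  have assoc: "A * B * C = A * (B * C)" if "A \<in> carrier_mat n n" "B \<in> carrier_mat n n" "C \<in> carrier_mat n n" for A B C :: "complex mat"
    using that by (rule assoc_mult_mat)
  have mc: "A * B \<in> carrier_mat n n" if "A \<in> carrier_mat n n" "B \<in> carrier_mat n n" for A B :: "complex mat"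
    using that by (rule mult_carrier_mat)
  have XQX': "X * (Q k * X) = X" if "k < d" for k
    using XQX[OF that] assoc[OF X(1) Q(1)[OF that] X(1)] by simp
  \<comment> \<open>Each summand collapses by \<open>X Q X = X\<close> to \<open>Q k * X\<close>,
    and the \<open>Q k\<close> add up to the identity.\<close>
  have "Y * X = matrix_sum n n (\<lambda>k. Q k * X * Q k * X) {..<d}"
    unfolding Ydef by (rule matrix_sum_mult_right) (use X cT in auto)
  also have "\<dots> = matrix_sum n n (\<lambda>k. Q k * X) {..<d}"
    by (rule matrix_sum_cong) (simp add: assoc mc X(1) Q(1) XQX')
  also have "\<dots> = matrix_sum n n Q {..<d} * X"
    by (rule matrix_sum_mult_right[symmetric]) (use X Q in auto)
  also have "\<dots> = X" using Q_sum X(1) by (simp add: n_def)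
  finally have YX: "Y * X = X" .
  have hT: "mat_adjoint (Q k * X * Q k) = Q k * X * Q k" if "k < d" for k
    using mat_adjoint_mult[OF mc[OF Q(1)[OF that] X(1)] Q(1)[OF that]] mat_adjoint_mult[OF Q(1)[OF that] X(1)]
    by (simp add: Q(2)[OF that] X(2) assoc[OF Q(1)[OF that] X(1) Q(1)[OF that]])
  have hY: "mat_adjoint Y = Y"
    unfolding Ydef by (subst mat_adjoint_matrix_sum) (use cT hT in \<open>auto intro!: matrix_sum_cong\<close>)
  have XY: "X * Y = X"
    using mat_adjoint_mult[OF cY X(1)] YX hY X(2) by simp
  have YY: "Y * Y = Y"
    \<comment> \<open>The summands are themselves orthogonal idempotents: the square of
      \<open>Q X Q\<close> is \<open>Q (X Q X) Q\<close>, and different \<open>k\<close> meet in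
      \<open>Q j * Q k = 0\<close>.\<close>
    unfolding Ydef
  proof (rule matrix_sum_mult_orthogonal)
    fix k assume "k \<in> {..<d}"
    then have k: "k < d" by simp
    show "Q k * X * Q k \<in> carrier_mat n n" by (rule cT[OF k])
    have "Q k * X * Q k * (Q k * X * Q k) = Q k * (X * ((Q k * Q k) * X)) * Q k"
      by (simp only: assoc mc X(1) Q(1)[OF k])
    then show "Q k * X * Q k * (Q k * X * Q k) = Q k * X * Q k" by (simp only: Q(3)[OF k] XQX'[OF k])
    fix j assume "j \<in> {..<d}" "j \<noteq> k"
    then have j: "j < d" "j \<noteq> k" by auto
    have "Q j * X * Q j * (Q k * X * Q k) = Q j * X * ((Q j * Q k) * (X * Q k))"
      by (simp only: assoc mc X(1) Q(1)[OF k] Q(1)[OF j(1)])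
    also have "\<dots> = 0\<^sub>m n n"
      unfolding Q_orth[OF j(1) k j(2), folded n_def] left_mult_zero_mat[OF mc[OF X(1) Q(1)[OF k]]]
      by (rule right_mult_zero_mat[OF mc[OF Q(1)[OF j(1)] X(1)]])
    finally show "Q j * X * Q j * (Q k * X * Q k) = 0\<^sub>m n n" .
  qed simp
  have "matrix_trace Y = (\<Sum>k<d. matrix_trace (Q k * X * Q k))"
    unfolding Ydef by (rule matrix_trace_matrix_sum) (use cT in auto)
  also have "\<dots> = (\<Sum>k<d. matrix_trace (Q k * X))"
  proof (rule sum.cong[OF refl])
    fix k assume "k \<in> {..<d}"
    then have k: "k < d" by simp
    have "matrix_trace (Q k * X * Q k) = matrix_trace (Q k * (Q k * X))"
      by (rule matrix_trace_mult_comm[of _ n n]) (use Q(1)[OF k] X(1) mc in auto)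
    also have "Q k * (Q k * X) = Q k * X"
      using assoc[OF Q(1)[OF k] Q(1)[OF k] X(1)] Q(3)[OF k] by simp
    finally show "matrix_trace (Q k * X * Q k) = matrix_trace (Q k * X)" .
  qed
  also have "\<dots> = matrix_trace (matrix_sum n n (\<lambda>k. Q k * X) {..<d})"
    by (rule matrix_trace_matrix_sum[symmetric]) (use mc[OF Q(1) X(1)] in auto)
  also have "matrix_sum n n (\<lambda>k. Q k * X) {..<d} = X"
    using matrix_sum_mult_right[of X n n "{..<d}" Q n] Q_sum X(1) Q(1) by (simp add: n_def)
  finally have trY: "matrix_trace Y = of_nat d" using X(4) by simp
  \<comment> \<open>On the range of \<open>Y\<close>, the matrix \<open>X - Y\<close> is
    \<open>d - 1\<close> along the entangled vector and \<open>-1\<close> on its complement there.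
    Its absolute value is thus \<open>Y\<close> plus an excess of \<open>d - 2\<close> along that
    vector, where \<open>X\<close> has eigenvalue \<open>d\<close>. \<open>2 \<le> d\<close> makes
    \<open>c\<close> nonnegative and \<open>B\<close> positive.\<close>
  define c where "c = (real d - 2) / real d"
  have c: "0 \<le> c" "complex_of_real c * of_nat d = of_nat d - 2" 
    using assms(1) by (auto simp: c_def)
  define B where "B = Y + complex_of_real c \<cdot>\<^sub>m X"
  have cB: "B \<in> carrier_mat n n" using cY X(1) by (simp add: B_def)
  have psdX: "psd n X"
    by (rule psd_hermitian_square[where c = "real d"]) (use X d in auto)
  have "psd n Y"
    by (rule psd_hermitian_square[where c = 1]) (use cY hY YY in auto)
  then have psdB: "psd n B" unfolding B_def by (intro psd_add psd_smult psdX c)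
  define Z where "Z = X - Y"
  have cZ: "Z \<in> carrier_mat n n" unfolding Z_def by (rule minus_carrier_mat[OF cY])
  have "Z * Z = (X * X - Y * X) - (X * Y - Y * Y)"
    using X(1) cY cZ by (simp add: Z_def minus_mult_distrib_mat[of _ n n _ _ n] mult_minus_distrib_mat[of _ n n _ n])
  then have ZZ: "Z * Z = (of_nat d \<cdot>\<^sub>m X - X) - (X - Y)" by (simp add: X(3) YX XY YY)
  have "B * B = (Y * Y + complex_of_real c \<cdot>\<^sub>m (X * Y)) + complex_of_real c \<cdot>\<^sub>m (Y * X + complex_of_real c \<cdot>\<^sub>m (X * X))"
    using X(1) cY cB by (simp add: B_def add_mult_distrib_mat[of _ n n _ _ n] mult_add_distrib_mat[of _ n n _ n]
      mult_smult_distrib[of _ n n _ n] mult_smult_assoc_mat[of _ n n _ n])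
  then have BB: "B * B = (Y + complex_of_real c \<cdot>\<^sub>m X) + complex_of_real c \<cdot>\<^sub>m (X + (complex_of_real c * of_nat d) \<cdot>\<^sub>m X)"
    by (simp add: X(3) YX XY YY smult_smult_mat)
  \<comment> \<open>The coefficient of \<open>X\<close> in \<open>B * B\<close> is
    \<open>2 c + c^2 d\<close>, and \<open>c d = d - 2\<close> turns it into \<open>c d\<close>;
    this matches \<open>Z * Z = Y + (d - 2) X\<close>.\<close>
  have cc: "complex_of_real c + (complex_of_real c + complex_of_real c * (complex_of_real c * of_nat d)) = of_nat d - 2"
    unfolding c(2) using c(2) by (simp add: algebra_simps)
  have "B * B = mat_adjoint Z * Z"
  proof -
    have "mat_adjoint Z = Z" using mat_adjoint_minus[OF X(1) cY] by (simp add: Z_def X(2) hY)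
    moreover have "B * B = Z * Z"
    proof (rule eq_matI)
      fix i j assume "i < dim_row (Z * Z)" "j < dim_col (Z * Z)"
      then have ij: "i < n" "j < n" using cZ by auto
      have "(B * B) $$ (i, j) = Y $$ (i, j) + (complex_of_real c + (complex_of_real c + complex_of_real c * (complex_of_real c * of_nat d))) * X $$ (i, j)"
        unfolding BB using X(1) cY ij by (simp add: algebra_simps)
      also have "\<dots> = (Z * Z) $$ (i, j)"
        unfolding cc ZZ using X(1) cY ij by (simp add: algebra_simps)
      finally show "(B * B) $$ (i, j) = (Z * Z) $$ (i, j)" .
    qed (use cB cZ in auto)
    ultimately show ?thesis by simp
  qed
  then have "trace_norm (complex_of_real b \<cdot>\<^sub>m Z) = \<bar>b\<bar> * Re (matrix_trace B)"
    by (rule trace_norm_smult[OF cZ psdB])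
  also have "matrix_trace B = of_nat d + (of_nat d - 2)"
    using cY X(1) trY X(4) c(2) by (simp add: B_def matrix_trace_add[of _ n] matrix_trace_smult[of _ n])
  finally show ?thesis by (simp add: Z_def X_def Y_def)
qed

text \<open>Here \<open>X Q\<^sub>k = L\<^sub>k X\<close> with \<open>L\<^sub>k\<close> acting on the second factor, so
  \<open>X - \<Sum> Q\<^sub>k X Q\<^sub>k = X (1 - \<Sum> L\<^sub>k Q\<^sub>k)\<close>.\<close>

lemma trace_norm_flip_op:
  assumes U: "U \<in> carrier_mat d d" "U * mat_adjoint U = 1\<^sub>m d"
  shows "trace_norm (complex_of_real b \<cdot>\<^sub>m (flip_op d U - local_measure_map d P (flip_op d U))) =
    \<bar>b\<bar> * (real d * (real d - 1))"
proof -
  define n where "n = d * d"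
  define X where "X = flip_op d U"
  define P' where "P' k = mat_adjoint U * P k * U" for k
  \<comment> \<open>\<open>P' k\<close> is the projector that \<open>P k\<close> becomes when
    carried through the flip, so the \<open>M k\<close> are orthogonal projections of trace one and
    their sum \<open>R\<close> has trace \<open>d\<close>.\<close>
  define M where "M k = kron (P k) (P' k)" for k
  define R where "R = matrix_sum n n M {..<d}"
  have X: "X \<in> carrier_mat n n" "mat_adjoint X = X" "X * X = 1\<^sub>m n"
    using flip_op_hermitian[OF d U] flip_op_square[OF d U] by (auto simp: X_def n_def)
  note Q = QD[folded n_def]
  have U': "mat_adjoint U \<in> carrier_mat d d" "mat_adjoint (mat_adjoint U) * mat_adjoint U = 1\<^sub>m d"
    using U by simp_all
  note conj = mult_conjugation[OF U', unfolded mat_adjoint_adjoint]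
  have P': "P' k \<in> carrier_mat d d" "mat_adjoint (P' k) = P' k" "P' k * P' k = P' k" "matrix_trace (P' k) = 1" if "k < d" for k
  proof -
    note p = measurementD[OF that]
    show c: "P' k \<in> carrier_mat d d" using p U unfolding P'_def by (intro mult_carrier_mat[of _ d d]) auto
    show "P' k * P' k = P' k" using conj[OF p(1) p(1)] by (simp add: P'_def p(3))
    show "mat_adjoint (P' k) = P' k"
      using mat_adjoint_mult[OF mult_carrier_mat[OF U'(1) p(1)] U(1)] mat_adjoint_mult[OF U'(1) p(1)]
        assoc_mult_mat[OF U'(1) p(1) U(1)] by (simp add: P'_def p(2))
    have "matrix_trace (P' k) = matrix_trace (U * (mat_adjoint U * P k))"
      unfolding P'_def by (rule matrix_trace_mult_comm[of _ d d]) (use p U in auto)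
    also have "U * (mat_adjoint U * P k) = P k"
      using assoc_mult_mat[of U d d "mat_adjoint U" d "P k" d] p U by simp
    finally show "matrix_trace (P' k) = 1" using p by simp
  qed
  have M: "M k \<in> carrier_mat n n" "mat_adjoint (M k) = M k" "M k * M k = M k" "matrix_trace (M k) = 1" if "k < d" for k
    using measurementD[OF that] P'[OF that]
    by (auto simp: M_def n_def mat_adjoint_kron[where d = d] kron_mult[where d = d] matrix_trace_kron[OF d])
  have M_orth: "M j * M k = 0\<^sub>m n n" if "j < d" "k < d" "j \<noteq> k" for j k
    using measurementD(1)[OF that(1)] measurementD(1)[OF that(2)] P'(1)[OF that(1)] P'(1)[OF that(2)] measurement_orthogonal[OF that]
    by (simp add: M_def n_def kron_mult[where d = d])
  have cR: "R \<in> carrier_mat n n" by (simp add: R_def)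
  have hR: "mat_adjoint R = R"
    unfolding R_def by (subst mat_adjoint_matrix_sum) (use M in \<open>auto intro!: matrix_sum_cong\<close>)
  have RR: "R * R = R"
    unfolding R_def by (rule matrix_sum_mult_orthogonal) (use M M_orth in auto)
  have trR: "matrix_trace R = of_nat d"
    unfolding R_def by (subst matrix_trace_matrix_sum) (use M in auto)
  have QXQ: "Q k * X * Q k = X * M k" if k: "k < d" for k
  proof -
    let ?L = "kron (1\<^sub>m d) (P' k)"
    have L: "?L \<in> carrier_mat n n" "mat_adjoint ?L = ?L"
      using P'[OF k] by (auto simp: n_def mat_adjoint_kron[where d = d])
    have "X * Q k = ?L * X"
      unfolding X_def P'_def by (rule flip_op_kron_swap[OF d U measurementD(1)[OF k]])
    \<comment> \<open>Adjoints reverse the swap, giving \<open>Q k * X = X * ?L\<close> without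
      inverting \<open>X\<close>.\<close>
    then have "mat_adjoint (X * Q k) = mat_adjoint (?L * X)" by simp
    then have "Q k * X = X * ?L"
      using mat_adjoint_mult[OF X(1) Q(1)[OF k]] mat_adjoint_mult[OF L(1) X(1)] by (simp add: X(2) Q(2)[OF k] L(2))
    then have "Q k * X * Q k = X * (?L * Q k)"
      using assoc_mult_mat[OF X(1) L(1) Q(1)[OF k]] by simp
    also have "?L * Q k = M k"
      using measurementD(1)[OF k] P'(1)[OF k] by (simp add: M_def kron_mult[where d = d])
    finally show ?thesis .
  qed
  have "local_measure_map d P X = matrix_sum n n (\<lambda>k. X * M k) {..<d}"
    unfolding local_measure_map_def n_def[symmetric] by (rule matrix_sum_cong) (simp add: QXQ)
  also have "\<dots> = X * R"
    unfolding R_def by (rule matrix_sum_mult_left[symmetric]) (use X M in auto)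
  finally have Y: "local_measure_map d P X = X * R" .
  define B where "B = 1\<^sub>m n - R"
  have cB: "B \<in> carrier_mat n n" unfolding B_def by (rule minus_carrier_mat[OF cR])
  have hB: "mat_adjoint B = B" using mat_adjoint_minus[OF one_carrier_mat cR] by (simp add: B_def hR)
  have "B * B = (1\<^sub>m n - R) - (R - R)"
    using cR cB by (simp add: B_def minus_mult_distrib_mat[of _ n n _ _ n] mult_minus_distrib_mat[of _ n n _ n] RR)
  then have BB: "B * B = B" using cR by (intro eq_matI) (auto simp: B_def simp del: index_mult_mat(1))
  have psdB: "psd n B"
    by (rule psd_hermitian_square[where c = 1]) (use cB hB BB in auto)
  have Z: "X - local_measure_map d P X = X * B"
    using X(1) cR by (simp add: Y B_def mult_minus_distrib_mat[of _ n n _ n])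
  \<comment> \<open>\<open>X\<close> is a Hermitian involution, so it disappears from the Gram
    matrix and the projection \<open>B\<close> is the absolute value of
    \<open>X * B\<close>.\<close>
  have "mat_adjoint (X * B) * (X * B) = B * (X * X * B)"
    using X(1) cB by (simp add: mat_adjoint_mult[OF X(1) cB] hB X(2) assoc_mult_mat[of _ n n _ n _ n])
  also have "\<dots> = B * B" using X(3) cB by simp
  finally have "trace_norm (complex_of_real b \<cdot>\<^sub>m (X * B)) = \<bar>b\<bar> * Re (matrix_trace B)"
    using X(1) cB by (intro trace_norm_smult[of _ n]) (auto simp: psdB)
  also have "matrix_trace B = of_nat n - of_nat d"
    using matrix_trace_minus[OF one_carrier_mat cR] by (simp add: B_def trR)
  finally show ?thesis unfolding Z[unfolded X_def, symmetric] X_def[symmetric] Z by (simp add: n_def algebra_simps)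
qed

end

section \<open>Discord\<close>

lemma special_unitaryD:
  "U \<in> special_unitary d \<Longrightarrow> U \<in> carrier_mat d d"
  "U \<in> special_unitary d \<Longrightarrow> U * mat_adjoint U = 1\<^sub>m d"
  by (simp_all add: special_unitary_def)

text \<open>The transpose of a unitary matrix is unitary by orthonormality of its columns. This
  makes the coefficient matrix of the second family unitary.\<close>

lemma unitary_mult_transpose:
  fixes U W :: "complex mat"
  assumes U: "U \<in> carrier_mat d d" "U * mat_adjoint U = 1\<^sub>m d"
    and W: "W \<in> carrier_mat d d" "W * mat_adjoint W = 1\<^sub>m d"
  shows "U * transpose_mat W * mat_adjoint (U * transpose_mat W) = 1\<^sub>m d"
proof -
  let ?T = "transpose_mat W"
  have T: "?T \<in> carrier_mat d d" using W by simp
  have TT: "?T * mat_adjoint ?T = 1\<^sub>m d"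
  proof (rule eq_matI)
    fix i j assume "i < dim_row (1\<^sub>m d :: complex mat)" "j < dim_col (1\<^sub>m d :: complex mat)"
    then have ij: "i < d" "j < d" by auto
    then have "(?T * mat_adjoint ?T) $$ (i, j) = (\<Sum>x<d. cnj (W $$ (x, j)) * W $$ (x, i))"
      using W(1) by (simp add: scalar_prod_def atLeast0LessThan mult.commute)
    then show "(?T * mat_adjoint ?T) $$ (i, j) = 1\<^sub>m d $$ (i, j)"
      using ij unitary_cols[OF W ij(2,1)] by auto
  qed (use W in auto)
  have "?T * (mat_adjoint ?T * mat_adjoint U) = mat_adjoint U"
    using assoc_mult_mat[of ?T d d "mat_adjoint ?T" d "mat_adjoint U" d] T U by (simp add: TT)
  then show ?thesis
    using U T assoc_mult_mat[OF U(1) T, of "mat_adjoint ?T * mat_adjoint U" d]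
    by (simp add: mat_adjoint_mult[OF U(1) T] mult_carrier_mat[of _ d d])
qed

text \<open>The trace is one for every \<open>t\<close>, so only positivity restricts
  \<open>t\<close>. As \<open>tr X = d\<close>, a scalar \<open>X\<close> with value
  \<open>p\<close> would force \<open>p * d = 1\<close>; the conditions \<open>ne\<close> exclude
  this for both eigenvalues.\<close>

lemma is_state_affine:
  fixes p q t :: real
  assumes d: "2 \<le> d" and X: "X \<in> carrier_mat (d * d) (d * d)" "mat_adjoint X = X" and pq: "p < q"
    and sq: "X * X = complex_of_real (- p * q) \<cdot>\<^sub>m 1\<^sub>m (d * d) + complex_of_real (p + q) \<cdot>\<^sub>m X"
    and tr: "matrix_trace X = of_nat d" and ne: "p * real d \<noteq> 1" "q * real d \<noteq> 1"
  shows "is_state (d * d) (complex_of_real ((1 - 2 * t / real d) / (real d)\<^sup>2) \<cdot>\<^sub>m 1\<^sub>m (d * d) +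
      complex_of_real (2 * t / (real d)\<^sup>2) \<cdot>\<^sub>m X) \<longleftrightarrow>
    0 \<le> 1 - 2 * t / real d + 2 * t * p \<and> 0 \<le> 1 - 2 * t / real d + 2 * t * q"
    (is "is_state _ ?\<rho> \<longleftrightarrow> _")
proof -
  have d0: "real d > 0" using d by simp
  have tr': "matrix_trace X \<noteq> complex_of_real (r * real (d * d))" if "r * real d \<noteq> 1" for r
  proof
    assume "matrix_trace X = complex_of_real (r * real (d * d))"
    then have "real d = r * real (d * d)"
      unfolding tr by (metis of_real_eq_iff of_real_of_nat_eq)
    then have "r * real d * real d = 1 * real d" by simp
    then show False using that d0 by simp
  qed
  have "matrix_trace ?\<rho> = complex_of_real ((1 - 2 * t / real d) / (real d)\<^sup>2 * real (d * d) + 2 * t / (real d)\<^sup>2 * real d)"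
    using X by (simp add: matrix_trace_add[of _ "d * d"] matrix_trace_smult[of _ "d * d"] tr)
  also have "(1 - 2 * t / real d) / (real d)\<^sup>2 * real (d * d) + 2 * t / (real d)\<^sup>2 * real d = 1"
    using d0 by (simp add: field_simps power2_eq_square)
  finally have tr1: "matrix_trace ?\<rho> = 1" by simp
  have scale: "0 \<le> (1 - 2 * t / real d) / (real d)\<^sup>2 + 2 * t / (real d)\<^sup>2 * r \<longleftrightarrow> 0 \<le> 1 - 2 * t / real d + 2 * t * r" for r
  proof -
    have "(1 - 2 * t / real d) / (real d)\<^sup>2 + 2 * t / (real d)\<^sup>2 * r = (1 - 2 * t / real d + 2 * t * r) / (real d)\<^sup>2"
      by (simp only: add_divide_distrib times_divide_eq_left)
    then show ?thesis using d0 by (simp add: zero_le_divide_iff)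
  qed
  show ?thesis
    unfolding is_state_def
    by (simp only: tr1 psd_two_eigenvalues[OF X pq sq tr'[OF ne(1)] tr'[OF ne(2)]] scale simp_thms)
qed

text \<open>Eigenvalue \<open>-1\<close> of the flip gives the upper bound on \<open>t\<close>,
  eigenvalue \<open>1\<close> the lower one.\<close>

lemma is_state_a:
  assumes d: "2 \<le> d" and V: "V \<in> adjoint_group d"
  shows "is_state (d * d) (lmm_operator d (t \<cdot>\<^sub>m V)) \<longleftrightarrow>
    - (real d / (2 * (real d - 1))) \<le> t \<and> t \<le> real d / (2 * (real d + 1))"
proof -
  obtain U where U: "U \<in> special_unitary d" "adjoint_rep d U V" using V by (auto simp: adjoint_group_def)
  note u = special_unitaryD[OF U(1)]
  have d0: "0 < d" and r: "2 \<le> real d" using d by auto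
  have "flip_op d U * flip_op d U = complex_of_real (- (- 1) * 1) \<cdot>\<^sub>m 1\<^sub>m (d * d) + complex_of_real (- 1 + 1) \<cdot>\<^sub>m flip_op d U"
    unfolding flip_op_square[OF d0 u] by (intro eq_matI) auto
  from is_state_affine[OF d flip_op_carrier flip_op_hermitian[OF d0 u] _ this matrix_trace_flip_op[OF d0 u]]
  have "is_state (d * d) (lmm_operator d (t \<cdot>\<^sub>m V)) \<longleftrightarrow>
      0 \<le> 1 - 2 * t / real d + 2 * t * (- 1) \<and> 0 \<le> 1 - 2 * t / real d + 2 * t * 1"
    unfolding lmm_operator_flip[OF d0 u U(2)] using r by simp
  also have "0 \<le> 1 - 2 * t / real d + 2 * t * (- 1) \<longleftrightarrow> t \<le> real d / (2 * (real d + 1))"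
    using r by (simp add: field_simps)
  also have "0 \<le> 1 - 2 * t / real d + 2 * t * 1 \<longleftrightarrow> - (real d / (2 * (real d - 1))) \<le> t"
    using r by (simp add: field_simps)
  finally show ?thesis by blast
qed

lemma discord_a:
  assumes d: "2 \<le> d" and V: "V \<in> adjoint_group d"
  shows "discord d (lmm_operator d (t \<cdot>\<^sub>m V)) = \<bar>t\<bar>"
proof -
  obtain U where U: "U \<in> special_unitary d" "adjoint_rep d U V" using V by (auto simp: adjoint_group_def)
  note u = special_unitaryD[OF U(1)]
  have d0: "0 < d" and r: "2 \<le> real d" using d by auto
  have "discord d (lmm_operator d (t \<cdot>\<^sub>m V)) =
      real d / (2 * (real d - 1)) * (\<bar>2 * t / (real d)\<^sup>2\<bar> * (real d * (real d - 1)))"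
    unfolding lmm_operator_flip[OF d0 u U(2)]
    by (rule discord_constant, subst local_measure_map_affine[OF d0 _ flip_op_carrier], assumption)
      (rule trace_norm_flip_op[OF d0 _ u])
  also have "\<dots> = \<bar>t\<bar>"
    using r by (simp add: abs_mult field_simps power2_eq_square)
  finally show ?thesis .
qed

text \<open>Eigenvalue \<open>0\<close> gives the upper bound \<open>d / 2\<close>; eigenvalue
  \<open>d\<close>, along the entangled vector, gives the lower one.\<close>

lemma is_state_aa:
  assumes d: "2 \<le> d" and V: "V \<in> adjoint_group d" and V': "V' \<in> adjoint_group d"
  shows "is_state (d * d) (lmm_operator d (t \<cdot>\<^sub>m (V * I0 d * transpose_mat V'))) \<longleftrightarrow>
    - (real d / (2 * ((real d)\<^sup>2 - 1))) \<le> t \<and> t \<le> real d / 2"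
proof -
  obtain U where U: "U \<in> special_unitary d" "adjoint_rep d U V" using V by (auto simp: adjoint_group_def)
  obtain U' where U': "U' \<in> special_unitary d" "adjoint_rep d U' V'" using V' by (auto simp: adjoint_group_def)
  note u = special_unitaryD[OF U(1)] and u' = special_unitaryD[OF U'(1)]
  define G where "G = U * transpose_mat U'"
  have G: "G \<in> carrier_mat d d" "G * mat_adjoint G = 1\<^sub>m d"
    using u u' unitary_mult_transpose[OF u u'] by (auto simp: G_def)
  have d0: "0 < d" and r: "2 \<le> real d" using d by auto
  have r1: "real d * real d > 1" using r by (metis less_1_mult less_le_trans one_less_numeral_iff semiring_norm(76))
  have "ent_op d G * ent_op d G = complex_of_real (- 0 * real d) \<cdot>\<^sub>m 1\<^sub>m (d * d) + complex_of_real (0 + real d) \<cdot>\<^sub>m ent_op d G"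
    unfolding ent_op_square[OF d0 G] by (intro eq_matI) auto
  from is_state_affine[OF d ent_op_carrier ent_op_hermitian[OF d0 G] _ this matrix_trace_ent_op[OF d0 G]]
  have "is_state (d * d) (lmm_operator d (t \<cdot>\<^sub>m (V * I0 d * transpose_mat V'))) \<longleftrightarrow>
      0 \<le> 1 - 2 * t / real d + 2 * t * 0 \<and> 0 \<le> 1 - 2 * t / real d + 2 * t * real d"
    unfolding lmm_operator_ent[OF d0 u U(2) u' U'(2)] G_def[symmetric] using r r1 by simp
  also have "0 \<le> 1 - 2 * t / real d + 2 * t * 0 \<longleftrightarrow> t \<le> real d / 2"
    using r by (simp add: field_simps)
  also have "0 \<le> 1 - 2 * t / real d + 2 * t * real d \<longleftrightarrow> - (real d / (2 * ((real d)\<^sup>2 - 1))) \<le> t"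
    using r r1 by (simp add: field_simps power2_eq_square)
  finally show ?thesis by blast
qed

lemma discord_aa:
  assumes d: "2 \<le> d" and V: "V \<in> adjoint_group d" and V': "V' \<in> adjoint_group d"
  shows "discord d (lmm_operator d (t \<cdot>\<^sub>m (V * I0 d * transpose_mat V'))) = 2 / real d * \<bar>t\<bar>"
proof -
  obtain U where U: "U \<in> special_unitary d" "adjoint_rep d U V" using V by (auto simp: adjoint_group_def)
  obtain U' where U': "U' \<in> special_unitary d" "adjoint_rep d U' V'" using V' by (auto simp: adjoint_group_def)
  note u = special_unitaryD[OF U(1)] and u' = special_unitaryD[OF U'(1)]
  have G: "U * transpose_mat U' \<in> carrier_mat d d" using u u' by auto
  have d0: "0 < d" and r: "2 \<le> real d" using d by auto
  have "discord d (lmm_operator d (t \<cdot>\<^sub>m (V * I0 d * transpose_mat V'))) =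
      real d / (2 * (real d - 1)) * (\<bar>2 * t / (real d)\<^sup>2\<bar> * (2 * (real d - 1)))"
    unfolding lmm_operator_ent[OF d0 u U(2) u' U'(2)]
    by (rule discord_constant, subst local_measure_map_affine[OF d0 _ ent_op_carrier], assumption)
      (rule trace_norm_ent_op[OF d0 _ d G unitary_mult_transpose[OF u u']])
  also have "\<dots> = 2 / real d * \<bar>t\<bar>"
    using r by (simp add: abs_mult field_simps power2_eq_square)
  finally show ?thesis .
qed

text \<open>The discord clauses hold for every representation of \<open>\<rho>\<close> within its
  family, so the value does not depend on the chosen \<open>t\<close> and group elements. Their
  intervals come from the equivalences, as members of either family are states.\<close>

theorem theorem6:
  fixes d :: nat
  assumes "3 \<le> d"
  shows
    "(\<forall>\<rho>\<in>states_a d. \<forall>t. \<forall>V\<in>adjoint_group d.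
        \<rho> = lmm_operator d (t \<cdot>\<^sub>m V) \<longrightarrow>
          discord d \<rho> = \<bar>t\<bar> \<and>
          - (real d / (2 * (real d - 1))) \<le> t \<and> t \<le> real d / (2 * (real d + 1))) \<and>
     (\<forall>V\<in>adjoint_group d. \<forall>t.
        is_state (d * d) (lmm_operator d (t \<cdot>\<^sub>m V)) \<longleftrightarrow>
          - (real d / (2 * (real d - 1))) \<le> t \<and> t \<le> real d / (2 * (real d + 1))) \<and>
     (\<forall>\<rho>\<in>states_aa d. \<forall>t. \<forall>V\<^sub>1\<in>adjoint_group d. \<forall>V\<^sub>2\<in>adjoint_group d.
        \<rho> = lmm_operator d (t \<cdot>\<^sub>m (V\<^sub>1 * I0 d * transpose_mat V\<^sub>2)) \<longrightarrow>
          discord d \<rho> = 2 / real d * \<bar>t\<bar> \<and>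
          - (real d / (2 * ((real d)\<^sup>2 - 1))) \<le> t \<and> t \<le> real d / 2) \<and>
     (\<forall>V\<^sub>1\<in>adjoint_group d. \<forall>V\<^sub>2\<in>adjoint_group d. \<forall>t.
        is_state (d * d) (lmm_operator d (t \<cdot>\<^sub>m (V\<^sub>1 * I0 d * transpose_mat V\<^sub>2))) \<longleftrightarrow>
          - (real d / (2 * ((real d)\<^sup>2 - 1))) \<le> t \<and> t \<le> real d / 2)"
proof -
  have d: "2 \<le> d" using assms by simp
  have "is_state (d * d) \<rho>" if "\<rho> \<in> states_a d \<or> \<rho> \<in> states_aa d" for \<rho>
    using that by (auto simp: states_a_def states_aa_def)
  then show ?thesis
    using is_state_a[OF d] discord_a[OF d] is_state_aa[OF d] discord_aa[OF d] by blast
qed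

end
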